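(* There is an absolute constant $c>0$ such that for every $n\ge 2$ and every total Boolean function $f:\{0,1\}^n\to\{0,1\}$, $$R_0(f)\le c\, Q_2(f)^2\, Q_0(f)\,\log n .$$
   Context: Query model: the input $Y=y_1\ldots y_n\in\{0,1\}^n$ is accessed only through queries to the bits $y_i$ (classically, or by the standard unitary query oracle in the quantum case); queries may be adaptive, and only queries are counted. $R_0(f)$ (zero-error randomized query complexity) is the minimum expected number of queries (worst case over $Y$) of a randomized algorithm that outputs $f(Y)$ with probability $1$ for every $Y$. $Q_2(f)$ (bounded-error quantum query complexity) is the minimum number of queries made by a quantum algorithm that outputs $f(Y)$ with probability at least $2/3$ for all $Y$. For $k\in\{0,1\}$, $Q_0^k(f)$ is the minimum number of queries made by a quantum algorithm that outputs $f(Y)$ with probability $1$ if $f(Y)=k$, and with probability at least $1/2$ if $f(Y)\ne k$. Then $Q_0(f)=\max\{Q_0^0(f),Q_0^1(f)\}$. *)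

theory Defs
  imports
    "HOL-Probability.Probability_Mass_Function"
    "Jordan_Normal_Form.Schur_Decomposition"
begin

text \<open>
  Inputs \<open>Y \<in> {0,1}\<^sup>n\<close> are lists of type \<^typ>\<open>bool list\<close> of length \<open>n\<close>, with positions
  \<open>0, \<dots>, n - 1\<close>. A function on \<open>{0,1}\<^sup>n\<close> is rendered as \<open>f :: bool list \<Rightarrow> bool\<close>;
  its values on lists of other lengths are never used.
\<close>

definition inputs :: "nat \<Rightarrow> bool list set" where
  "inputs n = {Y. length Y = n}"


subsection \<open>Randomized query algorithms\<close>

datatype dtree = Output bool | Query nat dtree dtree

text \<open>In \<open>Query i t0 t1\<close> the algorithm continues with \<open>t1\<close> if bit \<open>i\<close> is set, else with \<open>t0\<close>.\<close>

primrec dtree_valid :: "nat \<Rightarrow> dtree \<Rightarrow> bool" where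
  "dtree_valid n (Output b) \<longleftrightarrow> True"
| "dtree_valid n (Query i t0 t1) \<longleftrightarrow> i < n \<and> dtree_valid n t0 \<and> dtree_valid n t1"

primrec dtree_output :: "dtree \<Rightarrow> bool list \<Rightarrow> bool" where
  "dtree_output (Output b) Y = b"
| "dtree_output (Query i t0 t1) Y = (if Y ! i then dtree_output t1 Y else dtree_output t0 Y)"

primrec dtree_queries :: "dtree \<Rightarrow> bool list \<Rightarrow> nat" where
  "dtree_queries (Output b) Y = 0"
| "dtree_queries (Query i t0 t1) Y =
     Suc (if Y ! i then dtree_queries t1 Y else dtree_queries t0 Y)"

text \<open>
  A randomized algorithm is a probability distribution on deterministic ones. There are only
  countably many finite trees, so a pmf is general enough. Its support may be infinite; the
  expected number of queries is therefore taken in \<^typ>\<open>ennreal\<close>, where a divergent expectation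
  is \<open>\<infinity>\<close>.
\<close>

definition zero_error_randomized :: "nat \<Rightarrow> (bool list \<Rightarrow> bool) \<Rightarrow> dtree pmf \<Rightarrow> bool" where
  "zero_error_randomized n f p \<longleftrightarrow>
     (\<forall>t\<in>set_pmf p. dtree_valid n t) \<and>
     (\<forall>Y\<in>inputs n. measure_pmf.prob p {t. dtree_output t Y = f Y} = 1)"

definition R0 :: "nat \<Rightarrow> (bool list \<Rightarrow> bool) \<Rightarrow> ennreal" where
  "R0 n f =
     (INF p \<in> {p. zero_error_randomized n f p}.
        SUP Y \<in> inputs n. \<integral>\<^sup>+ t. of_nat (dtree_queries t Y) \<partial>measure_pmf p)"


subsection \<open>Quantum query algorithms\<close>

text \<open>
  The state space has basis states \<open>|i, b, z\<rangle>\<close> with a query register \<open>i < n\<close>, a target bit \<open>b\<close>,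
  and a workspace register \<open>z < m\<close>, numbered as follows.
\<close>

definition basis_index :: "nat \<Rightarrow> nat \<Rightarrow> bool \<Rightarrow> nat \<Rightarrow> nat" where
  "basis_index m i b z = (2 * i + of_bool b) * m + z"

definition space_dim :: "nat \<Rightarrow> nat \<Rightarrow> nat" where
  "space_dim n m = n * 2 * m"

text \<open>The standard oracle \<open>|i, b, z\<rangle> \<mapsto> |i, b \<oplus> y\<^sub>i, z\<rangle>\<close>; exclusive or is \<open>\<noteq>\<close> on \<^typ>\<open>bool\<close>.\<close>

definition oracle_mat :: "nat \<Rightarrow> nat \<Rightarrow> bool list \<Rightarrow> complex mat" where
  "oracle_mat n m Y =
     mat (space_dim n m) (space_dim n m)
       (\<lambda>(r, c). if \<exists>i b z. i < n \<and> z < m \<and> c = basis_index m i b z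
                           \<and> r = basis_index m i (b \<noteq> Y ! i) z
                 then 1 else 0)"

definition unitary_mat :: "nat \<Rightarrow> complex mat \<Rightarrow> bool" where
  "unitary_mat N U \<longleftrightarrow> U \<in> carrier_mat N N \<and> mat_adjoint U * U = 1\<^sub>m N"

text \<open>
  The algorithm applies \<open>U\<^sub>0\<close> to the first basis state, then alternates oracle calls with
  \<open>U\<^sub>1, \<dots>, U\<^sub>T\<close>, measures in the computational basis, and outputs \<open>1\<close> iff the observed basis
  state belongs to the accepting set.
\<close>

record qalgorithm =
  workspace :: nat
  unitary :: "nat \<Rightarrow> complex mat"
  accepting :: "nat set"

definition qalgorithm_valid :: "nat \<Rightarrow> nat \<Rightarrow> qalgorithm \<Rightarrow> bool" where
  "qalgorithm_valid n T A \<longleftrightarrow>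
     workspace A > 0 \<and> (\<forall>t\<le>T. unitary_mat (space_dim n (workspace A)) (unitary A t))"

primrec qstate :: "nat \<Rightarrow> qalgorithm \<Rightarrow> bool list \<Rightarrow> nat \<Rightarrow> complex vec" where
  "qstate n A Y 0 = unitary A 0 *\<^sub>v unit_vec (space_dim n (workspace A)) 0"
| "qstate n A Y (Suc t) = unitary A (Suc t) *\<^sub>v (oracle_mat n (workspace A) Y *\<^sub>v qstate n A Y t)"

definition output_prob :: "nat \<Rightarrow> nat \<Rightarrow> qalgorithm \<Rightarrow> bool list \<Rightarrow> bool \<Rightarrow> real" where
  "output_prob n T A Y b =
     (\<Sum>r | r < space_dim n (workspace A) \<and> (r \<in> accepting A \<longleftrightarrow> b).
        (cmod (vec_index (qstate n A Y T) r))\<^sup>2)"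

definition Q2 :: "nat \<Rightarrow> (bool list \<Rightarrow> bool) \<Rightarrow> nat" where
  "Q2 n f =
     (LEAST T. \<exists>A. qalgorithm_valid n T A \<and>
        (\<forall>Y\<in>inputs n. output_prob n T A Y (f Y) \<ge> 2 / 3))"

definition Q0_sided :: "bool \<Rightarrow> nat \<Rightarrow> (bool list \<Rightarrow> bool) \<Rightarrow> nat" where
  "Q0_sided k n f =
     (LEAST T. \<exists>A. qalgorithm_valid n T A \<and>
        (\<forall>Y\<in>inputs n.
           (f Y = k \<longrightarrow> output_prob n T A Y (f Y) = 1) \<and>
           (f Y \<noteq> k \<longrightarrow> output_prob n T A Y (f Y) \<ge> 1 / 2)))"

definition Q0 :: "nat \<Rightarrow> (bool list \<Rightarrow> bool) \<Rightarrow> nat" where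
  "Q0 n f = max (Q0_sided False n f) (Q0_sided True n f)"

end

theory Submission
  imports Defs
begin

text \<open>
  A bounded-error algorithm with \<open>T\<close> queries yields, for each input \<open>X\<close>, a distribution on
  positions: run it on \<open>X\<close> and measure the query register at a random time. By the hybrid
  argument this distribution hits a position where \<open>X\<close> and \<open>Y\<close> differ with probability
  \<open>\<Omega>(1/T\<^sup>2)\<close> whenever \<open>f Y \<noteq> f X\<close>. A one-sided-error algorithm yields a polynomial \<open>p\<close> of
  degree \<open>d \<le> 2 Q0\<close> with \<open>p Y \<noteq> 0\<close> iff \<open>f Y\<close>.

  The zero-error algorithm repeatedly takes a \<open>0\<close>-input \<open>X\<close> consistent with the answers so far and
  queries a position drawn from the distribution of \<open>X\<close>. Inside each inclusion-maximal monomial \<open>M\<close>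
  of the current polynomial some variables can be reset so as to turn \<open>X\<close> into a \<open>1\<close>-input, so the
  query hits \<open>M\<close> with probability \<open>\<Omega>(1/T\<^sup>2)\<close>. A hit replaces \<open>M\<close> by proper subsets of it. With
  weight \<open>(3 n)\<^sup>k\<close> for a maximal monomial of size \<open>k\<close> these subsets weigh at most half as much as
  \<open>M\<close>, so the expected total weight, initially \<open>n\<^bsup>O(d)\<^esup>\<close>, drops by a factor \<open>1 - \<Omega>(1/T\<^sup>2)\<close> per
  query, and \<open>O(T\<^sup>2 d log n)\<close> queries suffice.
\<close>

unbundle no vec_syntax  \<comment> \<open>\<open>$\<close> is the indexing of \<^typ>\<open>complex vec\<close>\<close>


subsection \<open>The hybrid argument\<close>

definition vec_l2 :: "complex vec \<Rightarrow> real" where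
  "vec_l2 v = L2_set (\<lambda>r. cmod (v $ r)) {..<dim_vec v}"

lemma vec_l2_nonneg: "vec_l2 v \<ge> 0"
  by (simp add: vec_l2_def L2_set_nonneg)

lemma vec_l2_power2: "(vec_l2 v)\<^sup>2 = (\<Sum>r<dim_vec v. (cmod (v $ r))\<^sup>2)"
  by (simp add: vec_l2_def L2_set_def sum_nonneg)

lemma vec_l2_triangle:
  assumes "u \<in> carrier_vec N" "v \<in> carrier_vec N" "w \<in> carrier_vec N"
  shows "vec_l2 (u - w) \<le> vec_l2 (u - v) + vec_l2 (v - w)"
proof -
  have "vec_l2 (u - w) \<le> L2_set (\<lambda>r. cmod ((u - v) $ r) + cmod ((v - w) $ r)) {..<N}"
    unfolding vec_l2_def
  proof (rule order_trans[OF _ L2_set_mono])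
    show "L2_set (\<lambda>r. cmod ((u - w) $ r)) {..<dim_vec (u - w)} \<le>
        L2_set (\<lambda>r. cmod ((u - w) $ r)) {..<N}"
      using assms by simp
    show "cmod ((u - w) $ r) \<le> cmod ((u - v) $ r) + cmod ((v - w) $ r)" if "r \<in> {..<N}" for r
      using norm_triangle_ineq[of "u $ r - v $ r" "v $ r - w $ r"] assms that by simp
  qed auto
  also have "\<dots> \<le> vec_l2 (u - v) + vec_l2 (v - w)"
    unfolding vec_l2_def using assms L2_set_triangle_ineq[of _ _ "{..<N}"] by simp
  finally show ?thesis .
qed

lemma of_real_vec_l2_power2: "complex_of_real ((vec_l2 v)\<^sup>2) = (\<Sum>r<dim_vec v. v $ r * cnj (v $ r))"
  unfolding vec_l2_power2 of_real_sum by (simp only: complex_norm_square)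

lemma mat_adjoint_mult_index:
  fixes U :: "complex mat"
  assumes "U \<in> carrier_mat N N" "d < N" "c < N"
  shows "(mat_adjoint U * U) $$ (d, c) = (\<Sum>r<N. cnj (U $$ (r, d)) * U $$ (r, c))"
  using assms by (simp add: mat_adjoint_def scalar_prod_def atLeast0LessThan)

lemma unitary_mat_columns:
  assumes "unitary_mat N U" "c < N" "d < N"
  shows "(\<Sum>r<N. cnj (U $$ (r, d)) * U $$ (r, c)) = of_bool (c = d)"
proof -
  have U: "U \<in> carrier_mat N N" "mat_adjoint U * U = 1\<^sub>m N"
    using assms by (auto simp: unitary_mat_def)
  from mat_adjoint_mult_index[OF U(1) assms(3,2)] show ?thesis
    using assms(2,3) unfolding U(2) by auto
qed

lemma mult_mat_vec_index:
  assumes "A \<in> carrier_mat N N" "v \<in> carrier_vec N" "r < N"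
  shows "(A *\<^sub>v v) $ r = (\<Sum>c<N. A $$ (r, c) * v $ c)"
  using assms by (simp add: scalar_prod_def atLeast0LessThan)

text \<open>Expanding the square gives a triple sum; with the row index summed innermost,
  orthonormality of the columns leaves only the diagonal terms.\<close>

lemma vec_l2_unitary:
  assumes U: "unitary_mat N U" and v: "v \<in> carrier_vec N"
  shows "vec_l2 (U *\<^sub>v v) = vec_l2 v"
proof -
  have UN: "U \<in> carrier_mat N N" using U by (simp add: unitary_mat_def)
  have "complex_of_real ((vec_l2 (U *\<^sub>v v))\<^sup>2) =
      (\<Sum>r<N. (\<Sum>c<N. U $$ (r, c) * v $ c) * cnj (\<Sum>d<N. U $$ (r, d) * v $ d))"
    unfolding of_real_vec_l2_power2
    using UN v by (simp add: mult_mat_vec_index del: index_mult_mat_vec)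
  also have "\<dots> = (\<Sum>r<N. \<Sum>c<N. \<Sum>d<N. v $ c * cnj (v $ d) * (cnj (U $$ (r, d)) * U $$ (r, c)))"
    by (simp add: sum_product mult_ac)
  also have "\<dots> = (\<Sum>c<N. \<Sum>r<N. \<Sum>d<N. v $ c * cnj (v $ d) * (cnj (U $$ (r, d)) * U $$ (r, c)))"
    by (rule sum.swap)
  also have "\<dots> = (\<Sum>c<N. \<Sum>d<N. v $ c * cnj (v $ d) * (\<Sum>r<N. cnj (U $$ (r, d)) * U $$ (r, c)))"
    unfolding sum_distrib_left by (intro sum.cong refl sum.swap)
  also have "\<dots> = (\<Sum>c<N. \<Sum>d<N. if d = c then v $ c * cnj (v $ d) else 0)"
    by (intro sum.cong refl) (auto simp: unitary_mat_columns[OF U])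
  also have "\<dots> = complex_of_real ((vec_l2 v)\<^sup>2)"
    unfolding of_real_vec_l2_power2 using v by simp
  finally have "(vec_l2 (U *\<^sub>v v))\<^sup>2 = (vec_l2 v)\<^sup>2" by (simp only: of_real_eq_iff)
  then show ?thesis using vec_l2_nonneg by (simp add: power2_eq_iff_nonneg)
qed

section \<open>Coordinates of the basis states and the action of the oracle\<close>

lemma basis_index_div_mod:
  assumes "z < m"
  shows "basis_index m i b z div m = 2 * i + of_bool b" "basis_index m i b z mod m = z"
  using assms by (auto simp: basis_index_def)

lemma basis_index_inject:
  assumes "z < m" "z' < m"
  shows "basis_index m i b z = basis_index m i' b' z' \<longleftrightarrow> i = i' \<and> b = b' \<and> z = z'"
proof
  assume eq: "basis_index m i b z = basis_index m i' b' z'"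
  have "2 * i + of_bool b = 2 * i' + of_bool b'" "z = z'"
    using basis_index_div_mod[OF assms(1), of i b] basis_index_div_mod[OF assms(2), of i' b'] eq
    by simp_all
  then show "i = i' \<and> b = b' \<and> z = z'" by (cases b; cases b'; simp; presburger)
qed simp

lemma basis_index_less:
  assumes "i < n" "z < m"
  shows "basis_index m i b z < space_dim n m"
proof -
  have "basis_index m i b z < (2 * i + of_bool b + 1) * m"
    using assms by (simp add: basis_index_def)
  also have "\<dots> \<le> (n * 2) * m" using assms by (intro mult_right_mono) (cases b; simp)+
  finally show ?thesis by (simp add: space_dim_def)
qed

lemma ex_basis_index:
  assumes "r < space_dim n m"
  shows "\<exists>i b z. i < n \<and> z < m \<and> r = basis_index m i b z"
proof (intro exI conjI)
  have m: "m > 0" using assms by (cases m) (auto simp: space_dim_def)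
  have "r div m < n * 2" using assms m by (simp add: space_dim_def less_mult_imp_div_less)
  then show "r div m div 2 < n" by (simp add: less_mult_imp_div_less)
  show "r mod m < m" using m by simp
  show "r = basis_index m (r div m div 2) (odd (r div m)) (r mod m)"
    by (simp add: basis_index_def flip: mod_2_eq_odd)
qed

text \<open>In sums over triples the oracle is a relabelling of the target bit alone.\<close>

lemma sum_space_dim:
  "(\<Sum>r<space_dim n m. g r) = (\<Sum>i<n. \<Sum>b\<in>UNIV. \<Sum>z<m. g (basis_index m i b z))"
proof -
  have "bij_betw (\<lambda>(i, b, z). basis_index m i b z) ({..<n} \<times> UNIV \<times> {..<m}) {..<space_dim n m}"
    unfolding bij_betw_def
  proof (intro conjI equalityI subsetI)
    show "inj_on (\<lambda>(i, b, z). basis_index m i b z) ({..<n} \<times> UNIV \<times> {..<m})"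
      by (auto simp: inj_on_def basis_index_inject)
    show "r \<in> {..<space_dim n m}"
      if "r \<in> (\<lambda>(i, b, z). basis_index m i b z) ` ({..<n} \<times> UNIV \<times> {..<m})" for r
      using that by (auto simp: basis_index_less)
    show "r \<in> (\<lambda>(i, b, z). basis_index m i b z) ` ({..<n} \<times> UNIV \<times> {..<m})"
      if r: "r \<in> {..<space_dim n m}" for r
    proof -
      obtain i b z where "i < n" "z < m" "r = basis_index m i b z"
        using ex_basis_index r by blast
      then show ?thesis by (intro image_eqI[of _ _ "(i, b, z)"]) auto
    qed
  qed
  from sum.reindex_bij_betw[OF this, of g] show ?thesis
    by (simp add: sum.cartesian_product case_prod_unfold)
qed

lemma oracle_mat_carrier: "oracle_mat n m Y \<in> carrier_mat (space_dim n m) (space_dim n m)"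
  by (simp add: oracle_mat_def)

lemma oracle_mat_apply:
  assumes v: "v \<in> carrier_vec (space_dim n m)" and i: "i < n" and z: "z < m"
  shows "(oracle_mat n m Y *\<^sub>v v) $ basis_index m i b z = v $ basis_index m i (b \<noteq> Y ! i) z"
proof -
  let ?r = "basis_index m i b z" and ?s = "basis_index m i (b \<noteq> Y ! i) z"
  note r = basis_index_less[OF i z]
  have ent: "oracle_mat n m Y $$ (?r, c) = of_bool (c = ?s)" if "c < space_dim n m" for c
  proof -
    have "(\<exists>i' b' z'. i' < n \<and> z' < m \<and> c = basis_index m i' b' z' \<and> ?r = basis_index m i' (b' \<noteq> Y ! i') z')
       \<longleftrightarrow> c = ?s"
    proof
      assume "c = ?s"
      moreover have "((b \<noteq> Y ! i) \<noteq> Y ! i) = b" by auto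
      ultimately show "\<exists>i' b' z'. i' < n \<and> z' < m \<and> c = basis_index m i' b' z' \<and>
          ?r = basis_index m i' (b' \<noteq> Y ! i') z'"
        using i z by (intro exI[of _ i] exI[of _ "b \<noteq> Y ! i"] exI[of _ z]) simp
    qed (use z in \<open>auto simp: basis_index_inject\<close>)
    then show ?thesis using that r by (simp add: oracle_mat_def)
  qed
  have "(oracle_mat n m Y *\<^sub>v v) $ ?r = (\<Sum>c<space_dim n m. if c = ?s then v $ c else 0)"
    unfolding mult_mat_vec_index[OF oracle_mat_carrier v r]
    by (intro sum.cong refl) (simp add: ent)
  then show ?thesis using r basis_index_less[OF i z] by simp
qed

lemma vec_l2_oracle:
  assumes v: "v \<in> carrier_vec (space_dim n m)"
  shows "vec_l2 (oracle_mat n m Y *\<^sub>v v) = vec_l2 v"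
proof -
  \<comment> \<open>Exclusive or with a fixed bit permutes the two values of the target bit.\<close>
  have flip: "(\<Sum>b\<in>UNIV. g (b \<noteq> c)) = (\<Sum>b\<in>UNIV. g b)" for g :: "bool \<Rightarrow> real" and c :: bool
    by (cases c) (auto simp: UNIV_bool)
  have "(vec_l2 (oracle_mat n m Y *\<^sub>v v))\<^sup>2 =
      (\<Sum>i<n. \<Sum>b\<in>UNIV. \<Sum>z<m. (cmod (v $ basis_index m i (b \<noteq> Y ! i) z))\<^sup>2)"
    using v oracle_mat_carrier[of n m Y]
    by (simp add: vec_l2_power2 sum_space_dim oracle_mat_apply del: index_mult_mat_vec)
  also have "\<dots> = (\<Sum>i<n. \<Sum>b\<in>UNIV. \<Sum>z<m. (cmod (v $ basis_index m i b z))\<^sup>2)"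
  proof (rule sum.cong)
    fix i
    show "(\<Sum>b\<in>UNIV. \<Sum>z<m. (cmod (v $ basis_index m i (b \<noteq> Y ! i) z))\<^sup>2) =
        (\<Sum>b\<in>UNIV. \<Sum>z<m. (cmod (v $ basis_index m i b z))\<^sup>2)"
      by (rule flip[of "\<lambda>b. \<Sum>z<m. (cmod (v $ basis_index m i b z))\<^sup>2"])
  qed simp
  also have "\<dots> = (vec_l2 v)\<^sup>2"
    using v by (simp add: vec_l2_power2 sum_space_dim)
  finally show ?thesis using vec_l2_nonneg by (simp add: power2_eq_iff_nonneg)
qed

text \<open>For a unit vector, this is the probability that measuring the query register gives
  \<open>i\<close>.\<close>

definition query_mass :: "nat \<Rightarrow> complex vec \<Rightarrow> nat \<Rightarrow> real" where
  "query_mass m v i = (\<Sum>b\<in>UNIV. \<Sum>z<m. (cmod (v $ basis_index m i b z))\<^sup>2)"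

lemma query_mass_nonneg: "query_mass m v i \<ge> 0"
  unfolding query_mass_def by (intro sum_nonneg) auto

lemma sum_query_mass:
  assumes "v \<in> carrier_vec (space_dim n m)"
  shows "(\<Sum>i<n. query_mass m v i) = (vec_l2 v)\<^sup>2"
  using assms by (simp add: query_mass_def vec_l2_power2 sum_space_dim)

text \<open>Where \<open>X\<close> and \<open>Y\<close> agree the two images coincide. Where they
  differ, the amplitudes \<open>p\<close>, \<open>q\<close> of the two target bits are swapped; each
  target bit contributes \<open>|p - q|^2\<close>, at most \<open>2 (|p|^2 + |q|^2)\<close>. This
  gives four times the query mass, and a factor 2 after taking the root.\<close>

lemma vec_l2_oracle_diff:
  assumes v: "v \<in> carrier_vec (space_dim n m)"
  shows "vec_l2 (oracle_mat n m X *\<^sub>v v - oracle_mat n m Y *\<^sub>v v)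
    \<le> 2 * sqrt (\<Sum>i | i < n \<and> X ! i \<noteq> Y ! i. query_mass m v i)"
proof -
  let ?u = "oracle_mat n m X *\<^sub>v v - oracle_mat n m Y *\<^sub>v v"
  let ?v = "\<lambda>i b z. v $ basis_index m i b z"
  note O = oracle_mat_carrier[of n m X] oracle_mat_carrier[of n m Y]
  have le: "(cmod (p - q))\<^sup>2 \<le> 2 * ((cmod p)\<^sup>2 + (cmod q)\<^sup>2)" for p q :: complex
  proof -
    have "(cmod (p - q))\<^sup>2 \<le> (cmod p + cmod q)\<^sup>2"
      by (intro power_mono norm_triangle_ineq4) auto
    moreover have "(cmod p + cmod q)\<^sup>2 + (cmod p - cmod q)\<^sup>2 = 2 * ((cmod p)\<^sup>2 + (cmod q)\<^sup>2)"
      by (simp add: power2_eq_square algebra_simps)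
    ultimately show ?thesis using zero_le_power2[of "cmod p - cmod q"] by linarith
  qed
  have "(vec_l2 ?u)\<^sup>2 =
      (\<Sum>i<n. \<Sum>b\<in>UNIV. \<Sum>z<m. (cmod (?v i (b \<noteq> X ! i) z - ?v i (b \<noteq> Y ! i) z))\<^sup>2)"
    using O v by (simp add: vec_l2_power2 sum_space_dim oracle_mat_apply basis_index_less del: index_mult_mat_vec)
  also have "\<dots> \<le> (\<Sum>i<n. if X ! i \<noteq> Y ! i then 4 * query_mass m v i else 0)"
  proof (rule sum_mono)
    fix i assume "i \<in> {..<n}"
    have "(\<Sum>b\<in>UNIV. \<Sum>z<m. (cmod (?v i (b \<noteq> X ! i) z - ?v i (b \<noteq> Y ! i) z))\<^sup>2) \<le> 4 * query_mass m v i"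
      if "X ! i \<noteq> Y ! i"
    proof -
      have "(\<Sum>b\<in>UNIV. \<Sum>z<m. (cmod (?v i (b \<noteq> X ! i) z - ?v i (b \<noteq> Y ! i) z))\<^sup>2) \<le>
         (\<Sum>b\<in>(UNIV::bool set). \<Sum>z<m. 2 * ((cmod (?v i True z))\<^sup>2 + (cmod (?v i False z))\<^sup>2))"
      proof (intro sum_mono)
        fix b z
        show "(cmod (?v i (b \<noteq> X ! i) z - ?v i (b \<noteq> Y ! i) z))\<^sup>2 \<le>
            2 * ((cmod (?v i True z))\<^sup>2 + (cmod (?v i False z))\<^sup>2)"
          using that le[of "?v i True z" "?v i False z"] le[of "?v i False z" "?v i True z"]
          by (cases b; cases "X ! i"; cases "Y ! i"; simp)
      qed
      also have "\<dots> = 4 * query_mass m v i"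
        by (simp add: query_mass_def UNIV_bool sum_distrib_left sum.distrib algebra_simps)
      finally show ?thesis .
    qed
    then show "(\<Sum>b\<in>UNIV. \<Sum>z<m. (cmod (?v i (b \<noteq> X ! i) z - ?v i (b \<noteq> Y ! i) z))\<^sup>2) \<le>
        (if X ! i \<noteq> Y ! i then 4 * query_mass m v i else 0)"
      by auto
  qed
  also have "\<dots> = (2 * sqrt (\<Sum>i | i < n \<and> X ! i \<noteq> Y ! i. query_mass m v i))\<^sup>2"
    by (simp add: power_mult_distrib sum_nonneg query_mass_nonneg sum.inter_filter[symmetric]
        sum_distrib_left)
  finally show ?thesis
    by (rule power2_le_imp_le) (simp add: sum_nonneg query_mass_nonneg)
qed

section \<open>Runs of one algorithm on two inputs\<close>

lemma qstate_carrier: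
  assumes "qalgorithm_valid n T A" "t \<le> T"
  shows "qstate n A Y t \<in> carrier_vec (space_dim n (workspace A))"
  using assms(2)
proof (induction t)
  case 0
  have "unitary A 0 \<in> carrier_mat (space_dim n (workspace A)) (space_dim n (workspace A))"
    using assms(1) by (simp add: qalgorithm_valid_def unitary_mat_def)
  then show ?case by simp
next
  case (Suc t)
  have "unitary A (Suc t) \<in> carrier_mat (space_dim n (workspace A)) (space_dim n (workspace A))"
    using assms(1) Suc.prems by (simp add: qalgorithm_valid_def unitary_mat_def)
  with Suc oracle_mat_carrier[of n "workspace A" Y] show ?case by simp
qed

lemma vec_l2_qstate:
  assumes A: "qalgorithm_valid n T A" and n: "n > 0" and t: "t \<le> T"
  shows "vec_l2 (qstate n A Y t) = 1"
  using t
proof (induction t)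
  case 0
  let ?N = "space_dim n (workspace A)"
  have N: "?N > 0" using A n by (simp add: space_dim_def qalgorithm_valid_def)
  have "(vec_l2 (unit_vec ?N 0))\<^sup>2 = (\<Sum>r<?N. if r = 0 then 1 else 0)"
    unfolding vec_l2_power2 using N by (intro sum.cong) auto
  then have "(vec_l2 (unit_vec ?N 0))\<^sup>2 = 1" using N by simp
  then have "vec_l2 (unit_vec ?N 0) = 1"
    using vec_l2_nonneg[of "unit_vec ?N 0"] by (simp add: power2_eq_1_iff)
  then show ?case
    using A vec_l2_unitary[of ?N "unitary A 0" "unit_vec ?N 0"] by (simp add: qalgorithm_valid_def)
next
  case (Suc t)
  let ?N = "space_dim n (workspace A)"
  have c: "qstate n A Y t \<in> carrier_vec ?N" using qstate_carrier[OF A] Suc.prems by simp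
  have "oracle_mat n (workspace A) Y *\<^sub>v qstate n A Y t \<in> carrier_vec ?N"
    using mult_mat_vec_carrier[OF oracle_mat_carrier c] .
  moreover have "unitary_mat ?N (unitary A (Suc t))"
    using A Suc.prems by (simp add: qalgorithm_valid_def)
  ultimately show ?case
    using Suc by (simp add: vec_l2_unitary vec_l2_oracle[OF c])
qed

text \<open>Adding and subtracting the \<open>Y\<close>-oracle applied to the state on
  \<open>X\<close> splits one step into two terms: the old difference, whose norm is preserved, and
  an oracle difference charged to the state on \<open>X\<close>. Only the run on \<open>X\<close> is
  charged, so the masses do not depend on \<open>Y\<close>; this allows one distribution to serve
  all \<open>Y\<close>.\<close>

lemma qstate_diff_le:
  assumes A: "qalgorithm_valid n T A" and t: "t \<le> T"
  shows "vec_l2 (qstate n A X t - qstate n A Y t) \<le>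
    2 * (\<Sum>s<t. sqrt (\<Sum>i | i < n \<and> X ! i \<noteq> Y ! i. query_mass (workspace A) (qstate n A X s) i))"
  using t
proof (induction t)
  case 0
  have "qstate n A X 0 - qstate n A Y 0 = 0\<^sub>v (space_dim n (workspace A))"
    using qstate_carrier[OF A, of 0 X] by simp
  then show ?case by (simp add: vec_l2_def L2_set_def)
next
  case (Suc t)
  let ?m = "workspace A" and ?x = "qstate n A X t" and ?y = "qstate n A Y t"
  let ?N = "space_dim n ?m"
  let ?OX = "oracle_mat n ?m X" and ?OY = "oracle_mat n ?m Y"
  have x: "?x \<in> carrier_vec ?N" and y: "?y \<in> carrier_vec ?N"
    using qstate_carrier[OF A] Suc.prems by simp_all
  have O: "?OX *\<^sub>v ?x \<in> carrier_vec ?N" "?OY *\<^sub>v ?x \<in> carrier_vec ?N" "?OY *\<^sub>v ?y \<in> carrier_vec ?N"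
    using mult_mat_vec_carrier[OF oracle_mat_carrier] x y by blast+
  have U: "unitary_mat ?N (unitary A (Suc t))" "unitary A (Suc t) \<in> carrier_mat ?N ?N"
    using A Suc.prems by (auto simp: qalgorithm_valid_def unitary_mat_def)
  have "vec_l2 (qstate n A X (Suc t) - qstate n A Y (Suc t)) =
      vec_l2 (unitary A (Suc t) *\<^sub>v (?OX *\<^sub>v ?x - ?OY *\<^sub>v ?y))"
    by (simp add: mult_minus_distrib_mat_vec[OF U(2) O(1,3)])
  also have "\<dots> = vec_l2 (?OX *\<^sub>v ?x - ?OY *\<^sub>v ?y)"
    using O by (intro vec_l2_unitary[OF U(1)]) simp
  also have "\<dots> \<le> vec_l2 (?OX *\<^sub>v ?x - ?OY *\<^sub>v ?x) + vec_l2 (?OY *\<^sub>v ?x - ?OY *\<^sub>v ?y)"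
    by (rule vec_l2_triangle[OF O])
  also have "?OY *\<^sub>v ?x - ?OY *\<^sub>v ?y = ?OY *\<^sub>v (?x - ?y)"
    by (rule mult_minus_distrib_mat_vec[OF oracle_mat_carrier x y, symmetric])
  also have "vec_l2 (?OY *\<^sub>v (?x - ?y)) = vec_l2 (?x - ?y)"
    using x y by (intro vec_l2_oracle) simp
  finally show ?case
    using vec_l2_oracle_diff[OF x, of X Y] Suc by simp
qed

section \<open>Output probabilities and the query distribution of an input\<close>

lemma output_prob_total:
  assumes A: "qalgorithm_valid n T A" and n: "n > 0"
  shows "output_prob n T A Y True + output_prob n T A Y False = 1"
proof -
  let ?N = "space_dim n (workspace A)" and ?p = "\<lambda>r. (cmod (qstate n A Y T $ r))\<^sup>2"
  have "output_prob n T A Y True + output_prob n T A Y False =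
      sum ?p ({r. r < ?N \<and> r \<in> accepting A} \<union> {r. r < ?N \<and> r \<notin> accepting A})"
    unfolding output_prob_def by (subst sum.union_disjoint) auto
  also have "\<dots> = sum ?p {..<?N}" by (rule sum.cong) auto
  also have "\<dots> = 1"
    using vec_l2_qstate[OF A n, of T Y] qstate_carrier[OF A, of T Y]
      vec_l2_power2[of "qstate n A Y T"] by simp
  finally show ?thesis .
qed

text \<open>The root of an output probability is the norm of the state restricted to the outcome
  set, so the triangle inequality applies.\<close>

lemma sqrt_output_prob_le:
  assumes A: "qalgorithm_valid n T A"
  shows "sqrt (output_prob n T A X b) \<le>
    sqrt (output_prob n T A Y b) + vec_l2 (qstate n A X T - qstate n A Y T)"
proof -
  let ?N = "space_dim n (workspace A)"
  let ?S = "{r. r < ?N \<and> (r \<in> accepting A \<longleftrightarrow> b)}"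
  let ?x = "qstate n A X T" and ?y = "qstate n A Y T"
  have c: "?x \<in> carrier_vec ?N" "?y \<in> carrier_vec ?N" using qstate_carrier[OF A] by simp_all
  have "L2_set (\<lambda>r. cmod (?x $ r)) ?S \<le> L2_set (\<lambda>r. cmod (?y $ r) + cmod (?x $ r - ?y $ r)) ?S"
    by (rule L2_set_mono) (use norm_triangle_ineq[of "?y $ r" "?x $ r - ?y $ r" for r] in auto)
  also have "\<dots> \<le> L2_set (\<lambda>r. cmod (?y $ r)) ?S + L2_set (\<lambda>r. cmod (?x $ r - ?y $ r)) ?S"
    by (rule L2_set_triangle_ineq)
  also have "L2_set (\<lambda>r. cmod (?x $ r - ?y $ r)) ?S \<le> vec_l2 (?x - ?y)"
  proof -
    have "(\<Sum>r\<in>?S. (cmod (?x $ r - ?y $ r))\<^sup>2) \<le> (\<Sum>r<?N. (cmod ((?x - ?y) $ r))\<^sup>2)"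
    proof -
      have "(\<Sum>r\<in>?S. (cmod (?x $ r - ?y $ r))\<^sup>2) = (\<Sum>r\<in>?S. (cmod ((?x - ?y) $ r))\<^sup>2)"
        using c by (intro sum.cong) auto
      also have "\<dots> \<le> (\<Sum>r<?N. (cmod ((?x - ?y) $ r))\<^sup>2)"
        by (rule sum_mono2) auto
      finally show ?thesis .
    qed
    then show ?thesis using c by (simp add: vec_l2_def L2_set_def)
  qed
  finally show ?thesis by (simp add: output_prob_def L2_set_def)
qed

text \<open>The roots of \<open>2 / 3\<close> and \<open>1 / 3\<close> are separated by the
  rationals \<open>4 / 5\<close> and \<open>3 / 5\<close>, whose squares are \<open>0.64\<close> and
  \<open>0.36\<close>.\<close>

lemma distinguishable_states:
  assumes A: "qalgorithm_valid n T A" and n: "n > 0"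
    and X: "output_prob n T A X b \<ge> 2 / 3" and Y: "output_prob n T A Y (\<not> b) \<ge> 2 / 3"
  shows "1 / 5 \<le> vec_l2 (qstate n A X T - qstate n A Y T)"
proof -
  have "output_prob n T A Y b \<le> 1 / 3"
    using output_prob_total[OF A n, of Y] Y by (cases b) auto
  then have "sqrt (output_prob n T A Y b) \<le> 3 / 5"
    by (intro real_le_lsqrt) (auto simp: power2_eq_square output_prob_def intro: sum_nonneg)
  moreover have "4 / 5 \<le> sqrt (output_prob n T A X b)"
    using X by (intro real_le_rsqrt) (auto simp: power2_eq_square)
  ultimately show ?thesis using sqrt_output_prob_le[OF A, of X b Y] by linarith
qed

lemma sum_sqrt_power2_le:
  fixes a :: "nat \<Rightarrow> real"
  assumes "\<And>t. a t \<ge> 0"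
  shows "(\<Sum>t<T. sqrt (a t))\<^sup>2 \<le> real T * (\<Sum>t<T. a t)"
  using Cauchy_Schwarz_ineq_sum[of "\<lambda>_. 1" "\<lambda>t. sqrt (a t)" "{..<T}"] assms by simp

lemma ex_query_distribution:
  assumes A: "qalgorithm_valid n T A" and n: "n > 0" and T: "T > 0"
    and correct: "\<And>Y. Y \<in> inputs n \<Longrightarrow> output_prob n T A Y (f Y) \<ge> 2 / 3"
    and X: "X \<in> inputs n"
  shows "\<exists>\<mu>. set_pmf \<mu> \<subseteq> {..<n} \<and> (\<forall>Y\<in>inputs n. f Y \<noteq> f X \<longrightarrow>
    1 / (100 * (real T)\<^sup>2) \<le> (\<Sum>i | i < n \<and> X ! i \<noteq> Y ! i. pmf \<mu> i))"
proof -
  let ?q = "\<lambda>t i. query_mass (workspace A) (qstate n A X t) i"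
  \<comment> \<open>The law of the measured query register at a uniformly random one of the
    \<open>T\<close> query times.\<close>
  define p where "p i = (if i < n then (\<Sum>t<T. ?q t i) / real T else 0)" for i
  have p0: "p i \<ge> 0" for i by (simp add: p_def sum_nonneg query_mass_nonneg)
  have "(\<Sum>i<n. \<Sum>t<T. ?q t i) = (\<Sum>t<T. \<Sum>i<n. ?q t i)" by (rule sum.swap)
  also have "\<dots> = (\<Sum>t<T. 1)"
    using vec_l2_qstate[OF A n] by (intro sum.cong refl) (simp add: sum_query_mass[OF qstate_carrier[OF A]])
  finally have sum1: "(\<Sum>i<n. p i) = 1" using T by (simp add: p_def sum_divide_distrib[symmetric])
  have "(\<integral>\<^sup>+ i. ennreal (p i) \<partial>count_space UNIV) = (\<Sum>i<n. ennreal (p i))"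
    by (rule nn_integral_count_space') (auto simp: p_def)
  also have "\<dots> = 1" using sum1 p0 by (simp add: sum_ennreal)
  finally have pmf: "pmf (embed_pmf p) i = p i" for i
    using p0 by (intro pmf_embed_pmf)
  show ?thesis
  proof (intro exI[of _ "embed_pmf p"] conjI ballI impI)
    show "set_pmf (embed_pmf p) \<subseteq> {..<n}" by (auto simp: set_pmf_iff pmf p_def split: if_splits)
    fix Y assume Y: "Y \<in> inputs n" and ne: "f Y \<noteq> f X"
    let ?D = "{i. i < n \<and> X ! i \<noteq> Y ! i}"
    have "1 / 5 \<le> vec_l2 (qstate n A X T - qstate n A Y T)"
      using distinguishable_states[OF A n, of X "f X" Y] correct[OF X] correct[OF Y] ne by (cases "f X") auto
    also have "\<dots> \<le> 2 * (\<Sum>t<T. sqrt (\<Sum>i\<in>?D. ?q t i))" using qstate_diff_le[OF A] by blast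
    \<comment> \<open>The factor 2 of \<open>qstate_diff_le\<close> halves \<open>1 / 5\<close>.
      Cauchy-Schwarz then costs one factor \<open>T\<close>, and passing from the sum over times to
      the mean \<open>p\<close> costs the other.\<close>
    finally have "(1 / 10)\<^sup>2 \<le> (\<Sum>t<T. sqrt (\<Sum>i\<in>?D. ?q t i))\<^sup>2"
      by (intro power_mono) auto
    also have "\<dots> \<le> real T * (\<Sum>t<T. \<Sum>i\<in>?D. ?q t i)"
      by (rule sum_sqrt_power2_le) (simp add: sum_nonneg query_mass_nonneg)
    also have "(\<Sum>t<T. \<Sum>i\<in>?D. ?q t i) = (\<Sum>i\<in>?D. \<Sum>t<T. ?q t i)" by (rule sum.swap)
    also have "\<dots> = real T * (\<Sum>i\<in>?D. p i)"
      unfolding sum_distrib_left using T by (intro sum.cong refl) (simp add: p_def)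
    finally have "1 / 100 \<le> (real T)\<^sup>2 * (\<Sum>i\<in>?D. p i)" by (simp add: power2_eq_square mult_ac)
    then show "1 / (100 * (real T)\<^sup>2) \<le> (\<Sum>i\<in>?D. pmf (embed_pmf p) i)"
      using T by (simp add: pmf field_simps)
  qed
qed

text \<open>Without a query the final state is the same on all inputs, so two function values cannot
  be told apart.\<close>

lemma queries_pos:
  assumes A: "qalgorithm_valid n T A" and n: "n > 0"
    and correct: "\<And>Y. Y \<in> inputs n \<Longrightarrow> output_prob n T A Y (f Y) \<ge> 2 / 3"
    and "X \<in> inputs n" "Y \<in> inputs n" "f X \<noteq> f Y"
  shows "T > 0"
proof (rule ccontr)
  assume "\<not> T > 0"
  then have "vec_l2 (qstate n A X T - qstate n A Y T) \<le> 0" using qstate_diff_le[OF A, of T X Y] by simp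
  moreover have "1 / 5 \<le> vec_l2 (qstate n A X T - qstate n A Y T)"
    using distinguishable_states[OF A n, of X "f X" Y] correct[of X] correct[of Y] assms(4-) by (cases "f X") auto
  ultimately show False by simp
qed


subsection \<open>The polynomial method\<close>

text \<open>A multilinear polynomial is represented by its coefficients, indexed by sets of
  variables.\<close>

definition poly_eval :: "nat \<Rightarrow> (nat set \<Rightarrow> complex) \<Rightarrow> bool list \<Rightarrow> complex" where
  "poly_eval n c Y = (\<Sum>M\<in>Pow {..<n}. c M * of_bool (\<forall>i\<in>M. Y ! i))"

definition poly_fun :: "nat \<Rightarrow> nat \<Rightarrow> (bool list \<Rightarrow> complex) \<Rightarrow> bool" where
  "poly_fun n d g \<longleftrightarrow>
     (\<exists>c. (\<forall>M. c M \<noteq> 0 \<longrightarrow> M \<subseteq> {..<n} \<and> card M \<le> d) \<and> (\<forall>Y. g Y = poly_eval n c Y))"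

lemma poly_fun_monomial:
  assumes "M \<subseteq> {..<n}" "card M \<le> d"
  shows "poly_fun n d (\<lambda>Y. a * of_bool (\<forall>i\<in>M. Y ! i))"
proof -
  have "poly_eval n (\<lambda>N. if N = M then a else 0) Y = a * of_bool (\<forall>i\<in>M. Y ! i)" for Y
  proof -
    have "poly_eval n (\<lambda>N. if N = M then a else 0) Y =
        (\<Sum>N\<in>Pow {..<n}. if N = M then a * of_bool (\<forall>i\<in>N. Y ! i) else 0)"
      unfolding poly_eval_def by (rule sum.cong) auto
    then show ?thesis using assms by simp
  qed
  then show ?thesis
    unfolding poly_fun_def using assms by (intro exI[of _ "\<lambda>N. if N = M then a else 0"]) auto
qed

lemma poly_fun_const: "poly_fun n d (\<lambda>_. a)"
  using poly_fun_monomial[of "{}" n d a] by simp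

lemma poly_fun_var: "i < n \<Longrightarrow> poly_fun n 1 (\<lambda>Y. of_bool (Y ! i))"
  using poly_fun_monomial[of "{i}" n 1 1] by simp

lemma poly_fun_add:
  assumes "poly_fun n d g" "poly_fun n d h"
  shows "poly_fun n d (\<lambda>Y. g Y + h Y)"
proof -
  obtain c where c: "\<And>M. c M \<noteq> 0 \<Longrightarrow> M \<subseteq> {..<n} \<and> card M \<le> d" "\<And>Y. g Y = poly_eval n c Y"
    using assms(1) by (auto simp: poly_fun_def)
  obtain c' where c': "\<And>M. c' M \<noteq> 0 \<Longrightarrow> M \<subseteq> {..<n} \<and> card M \<le> d" "\<And>Y. h Y = poly_eval n c' Y"
    using assms(2) by (auto simp: poly_fun_def)
  show ?thesis
    unfolding poly_fun_def
  proof (intro exI[of _ "\<lambda>M. c M + c' M"] conjI allI impI)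
    fix M assume "c M + c' M \<noteq> 0"
    then have "c M \<noteq> 0 \<or> c' M \<noteq> 0" by auto
    then show "M \<subseteq> {..<n}" "card M \<le> d" using c(1) c'(1) by blast+
  qed (simp add: c c' poly_eval_def sum.distrib distrib_right)
qed

lemma poly_fun_sum:
  "(\<And>i. i \<in> I \<Longrightarrow> poly_fun n d (g i)) \<Longrightarrow> poly_fun n d (\<lambda>Y. \<Sum>i\<in>I. g i Y)"
  by (induction I rule: infinite_finite_induct) (auto intro: poly_fun_const poly_fun_add)

lemma poly_fun_cnj:
  assumes "poly_fun n d g"
  shows "poly_fun n d (\<lambda>Y. cnj (g Y))"
proof -
  obtain c where c: "\<And>M. c M \<noteq> 0 \<Longrightarrow> M \<subseteq> {..<n} \<and> card M \<le> d" "\<And>Y. g Y = poly_eval n c Y"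
    using assms(1) by (auto simp: poly_fun_def)
  show ?thesis
    unfolding poly_fun_def
    by (intro exI[of _ "\<lambda>M. cnj (c M)"]) (use c(1) in \<open>auto simp: c(2) poly_eval_def\<close>)
qed

text \<open>Variables are idempotent on bits, so the product of the monomials \<open>M\<close> and
  \<open>N\<close> is the monomial \<open>M \<union> N\<close>, of size at most
  \<open>d + e\<close>.\<close>

lemma poly_fun_mult:
  assumes "poly_fun n d g" "poly_fun n e h"
  shows "poly_fun n (d + e) (\<lambda>Y. g Y * h Y)"
proof -
  obtain c where c: "\<And>M. c M \<noteq> 0 \<Longrightarrow> M \<subseteq> {..<n} \<and> card M \<le> d" "\<And>Y. g Y = poly_eval n c Y"
    using assms(1) by (auto simp: poly_fun_def)
  obtain c' where c': "\<And>M. c' M \<noteq> 0 \<Longrightarrow> M \<subseteq> {..<n} \<and> card M \<le> e" "\<And>Y. h Y = poly_eval n c' Y"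
    using assms(2) by (auto simp: poly_fun_def)
  have monomial: "poly_fun n (d + e) (\<lambda>Y. c M * c' N * of_bool (\<forall>i\<in>M \<union> N. Y ! i))" for M N
  proof (cases "c M = 0 \<or> c' N = 0")
    case True
    then show ?thesis using poly_fun_const[of n "d + e" 0] by auto
  next
    case False
    then show ?thesis
      using c(1)[of M] c'(1)[of N] card_Un_le[of M N]
      by (intro poly_fun_monomial) auto
  qed
  have "g Y * h Y = (\<Sum>M\<in>Pow {..<n}. \<Sum>N\<in>Pow {..<n}. c M * c' N * of_bool (\<forall>i\<in>M \<union> N. Y ! i))" for Y
    unfolding c(2) c'(2) poly_eval_def sum_product by (intro sum.cong refl) auto
  then show ?thesis by (simp only:) (intro poly_fun_sum monomial)
qed

lemma poly_fun_scale: "poly_fun n d g \<Longrightarrow> poly_fun n d (\<lambda>Y. a * g Y)"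
  using poly_fun_mult[OF poly_fun_const[of n 0 a], of d g] by simp

lemma poly_fun_mono: "poly_fun n d g \<Longrightarrow> d \<le> e \<Longrightarrow> poly_fun n e g"
  unfolding poly_fun_def by (meson order_trans)

section \<open>Amplitudes and output probabilities as polynomials in the input\<close>

lemma poly_fun_mult_mat_vec:
  assumes "U \<in> carrier_mat N N" "\<And>Y. v Y \<in> carrier_vec N" "r < N"
    and "\<And>c. c < N \<Longrightarrow> poly_fun n d (\<lambda>Y. v Y $ c)"
  shows "poly_fun n d (\<lambda>Y. (U *\<^sub>v v Y) $ r)"
  unfolding mult_mat_vec_index[OF assms(1,2,3)]
  by (intro poly_fun_sum poly_fun_scale assms(4)) simp

text \<open>The unitaries act linearly with constant coefficients; only an oracle call can raise the
  degree, and by at most one.\<close>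

lemma poly_fun_qstate:
  assumes A: "qalgorithm_valid n T A" and "t \<le> T" "r < space_dim n (workspace A)"
  shows "poly_fun n t (\<lambda>Y. qstate n A Y t $ r)"
  using assms(2,3)
proof (induction t arbitrary: r)
  case 0
  then show ?case by (simp add: poly_fun_const)
next
  case (Suc t)
  let ?m = "workspace A"
  let ?N = "space_dim n ?m"
  have U: "unitary A (Suc t) \<in> carrier_mat ?N ?N"
    using A Suc.prems by (simp add: qalgorithm_valid_def unitary_mat_def)
  have c: "qstate n A Y t \<in> carrier_vec ?N" for Y using qstate_carrier[OF A] Suc.prems by simp
  have "poly_fun n (Suc t) (\<lambda>Y. (oracle_mat n ?m Y *\<^sub>v qstate n A Y t) $ s)" if s: "s < ?N" for s
  proof -
    obtain i b z where i: "i < n" and z: "z < ?m" and s: "s = basis_index ?m i b z"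
      using ex_basis_index[OF s] by blast
    let ?g = "\<lambda>b Y. qstate n A Y t $ basis_index ?m i b z"
    have g: "poly_fun n t (?g b)" for b
      using Suc.IH Suc.prems basis_index_less[OF i z] by simp
    have x: "poly_fun n (Suc t) (\<lambda>Y. of_bool (Y ! i) * ?g b Y)" for b
      using poly_fun_mult[OF poly_fun_var[OF i] g[of b]] by simp
    \<comment> \<open>The new amplitude is \<open>y * (flipped) + (1 - y) * (unflipped)\<close> for
      the queried bit \<open>y\<close>.\<close>
    have "poly_fun n (Suc t) (\<lambda>Y. of_bool (Y ! i) * ?g (\<not> b) Y + (?g b Y + (- 1) * (of_bool (Y ! i) * ?g b Y)))"
      by (intro poly_fun_add poly_fun_scale x poly_fun_mono[OF g]) simp
    also have "(\<lambda>Y. of_bool (Y ! i) * ?g (\<not> b) Y + (?g b Y + (- 1) * (of_bool (Y ! i) * ?g b Y))) =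
        (\<lambda>Y. (oracle_mat n ?m Y *\<^sub>v qstate n A Y t) $ s)"
      unfolding s oracle_mat_apply[OF c i z] by (rule ext) (auto simp: of_bool_def)
    finally show ?thesis .
  qed
  then show ?case
    using poly_fun_mult_mat_vec[OF U mult_mat_vec_carrier[OF oracle_mat_carrier c] Suc.prems(2)] by simp
qed

text \<open>A squared modulus is an amplitude times its conjugate, which doubles the degree;
  conjugation only affects the coefficients.\<close>

lemma poly_fun_output_prob:
  assumes A: "qalgorithm_valid n T A"
  shows "poly_fun n (2 * T) (\<lambda>Y. of_real (output_prob n T A Y b))"
proof -
  have "of_real (output_prob n T A Y b) =
      (\<Sum>r | r < space_dim n (workspace A) \<and> (r \<in> accepting A \<longleftrightarrow> b).
        qstate n A Y T $ r * cnj (qstate n A Y T $ r))" for Y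
    unfolding output_prob_def of_real_sum by (simp only: complex_norm_square)
  moreover have "poly_fun n (T + T) (\<lambda>Y. qstate n A Y T $ r * cnj (qstate n A Y T $ r))"
    if "r < space_dim n (workspace A)" for r
    using that by (intro poly_fun_mult poly_fun_cnj poly_fun_qstate[OF A]) auto
  ultimately show ?thesis
    by (simp only: mult_2) (intro poly_fun_sum, simp)
qed


subsection \<open>An exact quantum algorithm\<close>

text \<open>A step of the exact algorithm is prescribed only on some basis states; being injective
  there, it extends to a permutation and hence to a unitary.\<close>

lemma inj_on_extends_to_bij:
  assumes "finite S" "A \<subseteq> S" "inj_on f A" "f ` A \<subseteq> S"
  shows "\<exists>g. bij_betw g S S \<and> (\<forall>x\<in>A. g x = f x)"
proof -
  have "card (S - A) = card (S - f ` A)"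
    using assms by (simp add: card_Diff_subset finite_subset card_image)
  then obtain h where h: "bij_betw h (S - A) (S - f ` A)"
    using finite_same_card_bij[of "S - A" "S - f ` A"] assms(1) by auto
  define g where "g x = (if x \<in> A then f x else h x)" for x
  have "bij_betw g (A \<union> (S - A)) (f ` A \<union> (S - f ` A))"
  proof (rule bij_betw_combine)
    show "bij_betw g A (f ` A)"
      using assms(3) by (simp add: bij_betw_def g_def inj_on_def image_def)
    show "bij_betw g (S - A) (S - f ` A)"
      using h by (subst bij_betw_cong[of _ _ h]) (auto simp: g_def)
  qed auto
  moreover have "A \<union> (S - A) = S" "f ` A \<union> (S - f ` A) = S" using assms by auto
  ultimately show ?thesis by (intro exI[of _ g]) (auto simp: g_def)
qed

definition permutation_mat :: "nat \<Rightarrow> (nat \<Rightarrow> nat) \<Rightarrow> complex mat" where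
  "permutation_mat N g = mat N N (\<lambda>(r, c). of_bool (r = g c))"

lemma unitary_permutation_mat:
  assumes "bij_betw g {..<N} {..<N}"
  shows "unitary_mat N (permutation_mat N g)"
proof -
  let ?P = "permutation_mat N g"
  have P: "?P \<in> carrier_mat N N" by (simp add: permutation_mat_def)
  have "mat_adjoint ?P * ?P = 1\<^sub>m N"
  proof (rule eq_matI)
    fix d c assume "d < dim_row (1\<^sub>m N :: complex mat)" "c < dim_col (1\<^sub>m N :: complex mat)"
    then have dc: "d < N" "c < N" by auto
    have gd: "g d < N" using assms dc by (auto simp: bij_betw_def)
    have "(mat_adjoint ?P * ?P) $$ (d, c) = (\<Sum>r<N. cnj (?P $$ (r, d)) * ?P $$ (r, c))"
      by (rule mat_adjoint_mult_index[OF P dc])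
    also have "\<dots> = (\<Sum>r<N. if r = g d then of_bool (g d = g c) else 0)"
      using dc by (intro sum.cong) (auto simp: permutation_mat_def)
    also have "\<dots> = of_bool (d = c)"
      using gd dc assms by (auto simp: bij_betw_def inj_on_def)
    finally show "(mat_adjoint ?P * ?P) $$ (d, c) = 1\<^sub>m N $$ (d, c)" using dc by simp
  qed (use P in \<open>auto simp: mat_adjoint_def\<close>)
  then show ?thesis using P by (simp add: unitary_mat_def)
qed

lemma permutation_mat_unit_vec:
  assumes "c < N"
  shows "permutation_mat N g *\<^sub>v unit_vec N c = unit_vec N (g c)"
  by (rule eq_vecI) (use assms in \<open>auto simp: permutation_mat_def unit_vec_def[of N "g c"]\<close>)

lemma oracle_unit_vec:
  assumes i: "i < n" and z: "z < m"
  shows "oracle_mat n m Y *\<^sub>v unit_vec (space_dim n m) (basis_index m i b z) =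
    unit_vec (space_dim n m) (basis_index m i (b \<noteq> Y ! i) z)"
proof (rule eq_vecI)
  fix r assume "r < dim_vec (unit_vec (space_dim n m) (basis_index m i (b \<noteq> Y ! i) z) :: complex vec)"
  then have r: "r < space_dim n m" by simp
  then obtain i' b' z' where r': "i' < n" "z' < m" "r = basis_index m i' b' z'"
    using ex_basis_index by blast
  have "basis_index m i' (b' \<noteq> Y ! i') z' < space_dim n m" by (rule basis_index_less) (use r' in auto)
  moreover have "basis_index m i' (b' \<noteq> Y ! i') z' = basis_index m i b z \<longleftrightarrow>
      basis_index m i' b' z' = basis_index m i (b \<noteq> Y ! i) z"
    using r' z by (auto simp: basis_index_inject)
  ultimately show "(oracle_mat n m Y *\<^sub>v unit_vec (space_dim n m) (basis_index m i b z)) $ r =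
      unit_vec (space_dim n m) (basis_index m i (b \<noteq> Y ! i) z) $ r"
    using r unfolding r'(3) by (simp add: oracle_mat_apply r'(1,2) unit_vec_def del: index_mult_mat_vec)
qed (use oracle_mat_carrier[of n m Y] in auto)

definition prefix_code :: "bool list \<Rightarrow> nat \<Rightarrow> nat" where
  "prefix_code Y t = (\<Sum>i<t. if Y ! i then 2 ^ i else 0)"

lemma prefix_code_less: "prefix_code Y t < 2 ^ t"
  by (induction t) (auto simp: prefix_code_def)

text \<open>Codes of length \<open>t\<close> stay below \<open>2 ^ t\<close>, so the summand
  \<open>2 ^ t\<close> reveals bit \<open>t\<close>.\<close>

lemma prefix_code_inject:
  "prefix_code X t = prefix_code Y t \<Longrightarrow> i < t \<Longrightarrow> X ! i = Y ! i"
proof (induction t)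
  case (Suc t)
  have "prefix_code X t = prefix_code Y t \<and> X ! t = Y ! t"
    using Suc.prems(1) prefix_code_less[of X t] prefix_code_less[of Y t]
    by (auto simp: prefix_code_def split: if_splits)
  with Suc show ?case by (auto simp: less_Suc_eq)
qed simp

text \<open>
  The exact algorithm queries the bits in order. Step \<open>t\<close> moves the answer, which is in the
  target bit, into bit \<open>t\<close> of the workspace and advances the query register.
\<close>

lemma ex_exact_algorithm:
  assumes n: "n > 0"
  shows "\<exists>T A. qalgorithm_valid n T A \<and> (\<forall>Y\<in>inputs n. output_prob n T A Y (f Y) = 1)"
proof -
  define m :: nat where "m = 2 ^ n"
  let ?N = "space_dim n m"
  define S where "S t = {basis_index m t b z | b z. z < 2 ^ t}" for t
  \<comment> \<open>The \<open>mod n\<close> sends the query register back to position 0 after the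
    last step, keeping it in range.\<close>
  have "\<exists>g. bij_betw g {..<?N} {..<?N} \<and> (\<forall>b z. z < 2 ^ t \<longrightarrow>
      g (basis_index m t b z) = basis_index m (Suc t mod n) False (z + (if b then 2 ^ t else 0)))"
    if t: "t < n" for t
  proof -
    have pow: "(2::nat) ^ Suc t \<le> m" unfolding m_def using t by (intro power_increasing) auto
    have dec: "basis_index m t b z div m = 2 * t + of_bool b" "basis_index m t b z mod m = z"
      if "z < 2 ^ t" for b z
      using that pow basis_index_div_mod[of z m t b] by simp_all
    define h where "h x = basis_index m (Suc t mod n) False (x mod m + (if odd (x div m) then 2 ^ t else 0))" for x
    have h: "h (basis_index m t b z) = basis_index m (Suc t mod n) False (z + (if b then 2 ^ t else 0))"
      if "z < 2 ^ t" for b z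
      by (cases b) (simp_all add: h_def dec that)
    have "inj_on h (S t)"
    proof (rule inj_onI)
      fix x y assume "x \<in> S t" "y \<in> S t" and eq: "h x = h y"
      then obtain b z b' z' where x: "x = basis_index m t b z" "z < 2 ^ t"
        and y: "y = basis_index m t b' z'" "z' < 2 ^ t" by (auto simp: S_def)
      have lt: "z + (if b then 2 ^ t else 0) < m" "z' + (if b' then 2 ^ t else 0) < m"
        using x(2) y(2) pow by (auto split: if_splits)
      have "z + (if b then 2 ^ t else 0) = z' + (if b' then 2 ^ t else 0)"
        using eq by (simp add: x(1) y(1) h[OF x(2)] h[OF y(2)] basis_index_inject[OF lt] del: mod_Suc_eq)
      \<comment> \<open>Both \<open>z\<close> and \<open>z'\<close> are below \<open>2 ^ t\<close>,
        so the sum reaches \<open>2 ^ t\<close> exactly when the target bit was set.\<close>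
      then have "b = b' \<and> z = z'" using x(2) y(2) by (cases b; cases b') auto
      then show "x = y" using x y by simp
    qed
    moreover have "S t \<subseteq> {..<?N}" "h ` S t \<subseteq> {..<?N}"
      using t n pow by (auto simp: S_def h intro!: basis_index_less)
    ultimately obtain g where "bij_betw g {..<?N} {..<?N}" "\<forall>x\<in>S t. g x = h x"
      using inj_on_extends_to_bij[of "{..<?N}" "S t" h] by auto
    moreover have "basis_index m t b z \<in> S t" if "z < 2 ^ t" for b z
      using that by (auto simp: S_def)
    ultimately show ?thesis by (intro exI[of _ g]) (simp add: h)
  qed
  then obtain g where g: "\<And>t. t < n \<Longrightarrow> bij_betw (g t) {..<?N} {..<?N}"
    "\<And>t b z. t < n \<Longrightarrow> z < 2 ^ t \<Longrightarrow>
      g t (basis_index m t b z) = basis_index m (Suc t mod n) False (z + (if b then 2 ^ t else 0))"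
    by metis
  define A where "A = \<lparr>workspace = m,
    unitary = (\<lambda>t. case t of 0 \<Rightarrow> permutation_mat ?N id | Suc s \<Rightarrow> permutation_mat ?N (g s)),
    accepting = {basis_index m 0 False (prefix_code Y n) | Y. Y \<in> inputs n \<and> f Y}\<rparr>"
  have valid: "qalgorithm_valid n n A"
    unfolding qalgorithm_valid_def
    by (auto simp: A_def m_def split: nat.split intro!: unitary_permutation_mat g(1)[unfolded m_def])
  have state: "qstate n A Y t = unit_vec ?N (basis_index m (t mod n) False (prefix_code Y t))"
    if "t \<le> n" for Y t
    using that
  proof (induction t)
    case 0
    have "0 < ?N" using n by (simp add: space_dim_def m_def)
    then show ?case by (simp add: A_def permutation_mat_unit_vec basis_index_def prefix_code_def)
  next
    case (Suc t)
    then have t: "t < n" by simp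
    have "(2::nat) ^ t \<le> m" unfolding m_def using t by (intro power_increasing) auto
    then have z: "prefix_code Y t < m" using prefix_code_less[of Y t] by simp
    show ?case
      using Suc t
      by (simp add: A_def oracle_unit_vec[OF t z] permutation_mat_unit_vec basis_index_less[OF t z]
          g(2)[OF t prefix_code_less] del: mod_Suc_eq) (simp add: prefix_code_def)
  qed
  have "output_prob n n A Y (f Y) = 1" if Y: "Y \<in> inputs n" for Y
  proof -
    let ?r = "basis_index m 0 False (prefix_code Y n)"
    have z: "prefix_code X n < m" for X using prefix_code_less[of X n] by (simp add: m_def)
    have r: "?r < ?N" by (rule basis_index_less[OF n z])
    have ws: "workspace A = m" by (simp add: A_def)
    have acc: "?r \<in> accepting A \<longleftrightarrow> f Y"
    proof
      assume "?r \<in> accepting A"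
      then obtain X where X: "X \<in> inputs n" "f X" "?r = basis_index m 0 False (prefix_code X n)"
        by (auto simp: A_def)
      then have "prefix_code X n = prefix_code Y n" by (simp add: basis_index_inject[OF z z])
      then have "X ! i = Y ! i" if "i < n" for i using that by (rule prefix_code_inject)
      then have "X = Y" using X(1) Y by (intro nth_equalityI) (auto simp: inputs_def)
      then show "f Y" using X by simp
    qed (use Y in \<open>auto simp: A_def\<close>)
    have "output_prob n n A Y (f Y) =
        (\<Sum>r | r < ?N \<and> (r \<in> accepting A \<longleftrightarrow> f Y). if r = ?r then 1 else 0)"
      unfolding output_prob_def by (intro sum.cong) (simp_all add: state ws unit_vec_def)
    also have "\<dots> = 1" using r acc by simp
    finally show ?thesis .
  qed
  with valid show ?thesis by blast
qed

text \<open>\<open>LEAST\<close> is meaningful only if some number of queries suffices; the exact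
  algorithm provides one, so the minimum is attained.\<close>

lemma Q2_algorithm:
  assumes "n > 0"
  obtains A where "qalgorithm_valid n (Q2 n f) A"
    "\<And>Y. Y \<in> inputs n \<Longrightarrow> output_prob n (Q2 n f) A Y (f Y) \<ge> 2 / 3"
proof -
  obtain T A where "qalgorithm_valid n T A" "\<forall>Y\<in>inputs n. output_prob n T A Y (f Y) = 1"
    using ex_exact_algorithm[OF assms] by blast
  then have "\<exists>T A. qalgorithm_valid n T A \<and> (\<forall>Y\<in>inputs n. output_prob n T A Y (f Y) \<ge> 2 / 3)"
    by (intro exI[of _ T] exI[of _ A]) simp
  from LeastI_ex[OF this] show ?thesis using that unfolding Q2_def by blast
qed

lemma Q0_sided_algorithm:
  assumes "n > 0"
  obtains A where "qalgorithm_valid n (Q0_sided k n f) A"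
    "\<And>Y. Y \<in> inputs n \<Longrightarrow> f Y = k \<Longrightarrow> output_prob n (Q0_sided k n f) A Y (f Y) = 1"
    "\<And>Y. Y \<in> inputs n \<Longrightarrow> f Y \<noteq> k \<Longrightarrow> output_prob n (Q0_sided k n f) A Y (f Y) \<ge> 1 / 2"
proof -
  obtain T A where "qalgorithm_valid n T A" "\<forall>Y\<in>inputs n. output_prob n T A Y (f Y) = 1"
    using ex_exact_algorithm[OF assms] by blast
  then have "qalgorithm_valid n T A \<and>
      (\<forall>Y\<in>inputs n. output_prob n T A Y (f Y) = 1 \<and> output_prob n T A Y (f Y) \<ge> 1 / 2)"
    by simp
  then have "\<exists>T A. qalgorithm_valid n T A \<and> (\<forall>Y\<in>inputs n.
           (f Y = k \<longrightarrow> output_prob n T A Y (f Y) = 1) \<and>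
           (f Y \<noteq> k \<longrightarrow> output_prob n T A Y (f Y) \<ge> 1 / 2))"
    by blast
  from LeastI_ex[OF this] show ?thesis using that unfolding Q0_sided_def by blast
qed

text \<open>An algorithm that is certain on \<open>0\<close>-inputs accepts them with probability 0
  and accepts \<open>1\<close>-inputs with probability at least \<open>1 / 2\<close>. Its acceptance
  probability is the polynomial.\<close>

lemma ex_nondeterministic_polynomial:
  assumes n: "n > 0"
  shows "\<exists>c. (\<forall>M. c M \<noteq> 0 \<longrightarrow> M \<subseteq> {..<n} \<and> card M \<le> 2 * Q0 n f) \<and>
    (\<forall>Y\<in>inputs n. f Y \<longleftrightarrow> poly_eval n c Y \<noteq> 0)"
proof -
  let ?T = "Q0_sided False n f"
  obtain A where A: "qalgorithm_valid n ?T A"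
    "\<And>Y. Y \<in> inputs n \<Longrightarrow> f Y = False \<Longrightarrow> output_prob n ?T A Y (f Y) = 1"
    "\<And>Y. Y \<in> inputs n \<Longrightarrow> f Y \<noteq> False \<Longrightarrow> output_prob n ?T A Y (f Y) \<ge> 1 / 2"
    by (rule Q0_sided_algorithm[OF n, of False f]) blast
  obtain c where c: "\<And>M. c M \<noteq> 0 \<Longrightarrow> M \<subseteq> {..<n} \<and> card M \<le> 2 * ?T"
    "\<And>Y. of_real (output_prob n ?T A Y True) = poly_eval n c Y"
    using poly_fun_output_prob[OF A(1), of True] by (auto simp: poly_fun_def)
  have "f Y \<longleftrightarrow> output_prob n ?T A Y True \<noteq> 0" if "Y \<in> inputs n" for Y
    using A(2,3)[OF that] output_prob_total[OF A(1) n, of Y] by (cases "f Y") auto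
  moreover have "M \<subseteq> {..<n} \<and> card M \<le> 2 * Q0 n f" if "c M \<noteq> 0" for M
  proof -
    have "2 * ?T \<le> 2 * Q0 n f" by (simp add: Q0_def)
    then show ?thesis using c(1)[OF that] by linarith
  qed
  ultimately show ?thesis by (intro exI[of _ c]) (auto simp: c(2)[symmetric])
qed


subsection \<open>The weight of the maximal monomials\<close>

definition maximal_monomials :: "(nat set \<Rightarrow> complex) \<Rightarrow> nat set set" where
  "maximal_monomials c = {M. c M \<noteq> 0 \<and> (\<forall>N. M \<subset> N \<longrightarrow> c N = 0)}"

text \<open>Substitution of \<open>b\<close> for variable \<open>i\<close>: the value 1 merges the
  monomial \<open>insert i M\<close> into \<open>M\<close>, the value 0 deletes it.\<close>

definition restrict_poly :: "nat \<Rightarrow> bool \<Rightarrow> (nat set \<Rightarrow> complex) \<Rightarrow> nat set \<Rightarrow> complex" where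
  "restrict_poly i b c M = (if i \<in> M then 0 else c M + (if b then c (insert i M) else 0))"

definition potential :: "nat \<Rightarrow> (nat set \<Rightarrow> complex) \<Rightarrow> real" where
  "potential n c = (\<Sum>M\<in>maximal_monomials c. (3 * real n) ^ card M)"

lemma poly_eval_restrict:
  assumes "i < n" "Y ! i = b"
  shows "poly_eval n (restrict_poly i b c) Y = poly_eval n c Y"
proof -
  let ?A = "{..<n} - {i}"
  let ?x = "\<lambda>M. of_bool (\<forall>j\<in>M. Y ! j) :: complex"
  have ins: "{..<n} = insert i ?A" using assms by auto
  have inj: "inj_on (insert i) (Pow ?A)" by (rule inj_onI) blast
  \<comment> \<open>Every monomial avoiding \<open>i\<close> is paired with the one obtained by
    adding \<open>i\<close>.\<close>
  have split: "(\<Sum>M\<in>Pow {..<n}. g M) = (\<Sum>M\<in>Pow ?A. g M + g (insert i M))" for g :: "nat set \<Rightarrow> complex"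
  proof -
    have "(\<Sum>M\<in>Pow {..<n}. g M) = (\<Sum>M\<in>Pow ?A \<union> insert i ` Pow ?A. g M)"
      by (subst ins, subst Pow_insert) simp
    also have "\<dots> = (\<Sum>M\<in>Pow ?A. g M) + (\<Sum>M\<in>insert i ` Pow ?A. g M)"
      by (rule sum.union_disjoint) auto
    also have "\<dots> = (\<Sum>M\<in>Pow ?A. g M + g (insert i M))"
      by (simp add: sum.reindex[OF inj] sum.distrib)
    finally show ?thesis .
  qed
  show ?thesis
    unfolding poly_eval_def split
    by (rule sum.cong) (use assms in \<open>auto simp: restrict_poly_def algebra_simps\<close>)
qed

lemma restrict_poly_support:
  assumes "restrict_poly i b c M \<noteq> 0"
  shows "i \<notin> M" "c M \<noteq> 0 \<or> c (insert i M) \<noteq> 0"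
  using assms by (auto simp: restrict_poly_def split: if_splits)

lemma ex_maximal_monomial:
  assumes "\<And>M. c M \<noteq> 0 \<Longrightarrow> M \<subseteq> {..<n}" "c N \<noteq> 0"
  shows "\<exists>M\<in>maximal_monomials c. N \<subseteq> M"
proof -
  have "finite {M. c M \<noteq> 0}"
    by (rule finite_subset[of _ "Pow {..<n}"]) (use assms in auto)
  from finite_has_maximal2[OF this, of N] assms(2) obtain M
    where "c M \<noteq> 0" "N \<subseteq> M" "\<forall>L. c L \<noteq> 0 \<longrightarrow> M \<subseteq> L \<longrightarrow> M = L" by auto
  then show ?thesis by (auto simp: maximal_monomials_def intro!: bexI[of _ M])
qed

lemma maximal_monomials_subset:
  assumes "\<And>M. c M \<noteq> 0 \<Longrightarrow> M \<subseteq> {..<n}"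
  shows "maximal_monomials c \<subseteq> Pow {..<n}"
  using assms by (auto simp: maximal_monomials_def)

lemma finite_maximal_monomials:
  assumes "\<And>M. c M \<noteq> 0 \<Longrightarrow> M \<subseteq> {..<n}"
  shows "finite (maximal_monomials c)"
  by (rule finite_subset[OF maximal_monomials_subset[OF assms]]) auto

section \<open>The effect of a substitution on the potential\<close>

lemma sum_Pow_power_card:
  fixes x :: "'b::comm_semiring_1"
  assumes "finite A"
  shows "(\<Sum>B\<in>Pow A. x ^ card B) = (x + 1) ^ card A"
  using prod_add[OF assms, of "\<lambda>_. x" "\<lambda>_. 1"] by simp

text \<open>With \<open>W = 3 n\<close> and \<open>k = card M\<close>, all subsets together weigh
  \<open>(W + 1)^k\<close>. Bernoulli and \<open>k \<le> n\<close> give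
  \<open>(1 - 1/W)^k \<ge> 2/3\<close>, while \<open>(W + 1) (1 - 1/W) \<le> W\<close>; so
  \<open>(W + 1)^k \<le> 3/2 W^k\<close>, and removing \<open>M\<close> itself leaves half its
  weight. The factor 3 in the weight is chosen for this.\<close>

lemma sum_psubsets_le:
  assumes "M \<subseteq> {..<n}"
  shows "(\<Sum>N\<in>Pow M - {M}. (3 * real n) ^ card N) \<le> (3 * real n) ^ card M / 2"
proof (cases "M = {}")
  case True
  then show ?thesis by simp
next
  case False
  let ?W = "3 * real n" and ?k = "card M"
  have fin: "finite M" using assms finite_subset by blast
  have n: "n > 0" using False assms by auto
  have kn: "?k \<le> n" using card_mono[OF _ assms] by simp
  have "1 - real ?k / ?W \<le> (1 - 1 / ?W) ^ ?k"
    using Bernoulli_inequality[of "- (1 / ?W)" ?k] n by (simp add: field_simps)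
  moreover have "real ?k / ?W \<le> 1 / 3" using kn n by (simp add: field_simps)
  ultimately have "2 / 3 \<le> (1 - 1 / ?W) ^ ?k" by linarith
  then have "(?W + 1) ^ ?k * (2 / 3) \<le> (?W + 1) ^ ?k * (1 - 1 / ?W) ^ ?k"
    by (intro mult_left_mono) auto
  also have "\<dots> = ((?W + 1) * (1 - 1 / ?W)) ^ ?k" by (simp add: power_mult_distrib)
  also have "\<dots> \<le> ?W ^ ?k"
  proof (rule power_mono)
    have "1 \<le> ?W" using n by simp
    then show "0 \<le> (?W + 1) * (1 - 1 / ?W)" by (intro mult_nonneg_nonneg) auto
    show "(?W + 1) * (1 - 1 / ?W) \<le> ?W" using n by (simp add: field_simps)
  qed
  finally have "(?W + 1) ^ ?k \<le> 3 / 2 * ?W ^ ?k" by simp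
  moreover have "(\<Sum>N\<in>Pow M - {M}. ?W ^ card N) = (?W + 1) ^ ?k - ?W ^ ?k"
    using fin sum_Pow_power_card[OF fin, of ?W] by (simp add: sum_diff1 del: power_mult_distrib)
  ultimately show ?thesis by linarith
qed

text \<open>A maximal \<open>M\<close> avoiding \<open>i\<close> keeps its coefficient, since
  \<open>insert i M\<close> has coefficient 0 by maximality; hence a new maximal monomial inside
  \<open>M\<close> equals \<open>M\<close>. If instead \<open>i\<close> is in \<open>M\<close>, it
  is a proper subset, as it avoids \<open>i\<close>.\<close>

lemma maximal_monomials_restrict:
  assumes "\<And>M. c M \<noteq> 0 \<Longrightarrow> M \<subseteq> {..<n}"
  shows "maximal_monomials (restrict_poly i b c) \<subseteq>
    {M \<in> maximal_monomials c. i \<notin> M} \<union> (\<Union>M\<in>{M \<in> maximal_monomials c. i \<in> M}. Pow M - {M})"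
proof
  fix N assume N: "N \<in> maximal_monomials (restrict_poly i b c)"
  then have nz: "restrict_poly i b c N \<noteq> 0" by (simp add: maximal_monomials_def)
  note sup = restrict_poly_support[OF nz]
  obtain M where M: "M \<in> maximal_monomials c" "N \<subseteq> M"
    using sup(2) ex_maximal_monomial[OF assms] by blast
  show "N \<in> {M \<in> maximal_monomials c. i \<notin> M} \<union> (\<Union>M\<in>{M \<in> maximal_monomials c. i \<in> M}. Pow M - {M})"
  proof (cases "i \<in> M")
    case True
    then show ?thesis using M sup by blast
  next
    case False
    then have "c M \<noteq> 0" "c (insert i M) = 0"
      using M(1) by (auto simp: maximal_monomials_def)
    then have "restrict_poly i b c M \<noteq> 0" using False by (simp add: restrict_poly_def)
    then have "N = M" using N M(2) by (auto simp: maximal_monomials_def)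
    then show ?thesis using M False by blast
  qed
qed

lemma sum_UN_le:
  fixes g :: "'b \<Rightarrow> real"
  assumes "finite I" "\<And>i. i \<in> I \<Longrightarrow> finite (A i)" "\<And>x. g x \<ge> 0"
  shows "sum g (\<Union>i\<in>I. A i) \<le> (\<Sum>i\<in>I. sum g (A i))"
  using assms(1,2)
proof (induction I rule: finite_induct)
  case (insert j I)
  have "sum g (A j \<union> (\<Union>i\<in>I. A i)) \<le> sum g (A j) + sum g (\<Union>i\<in>I. A i)"
    using insert.prems insert.hyps(1) assms(3)
    by (subst sum.union_inter[symmetric]) (auto intro!: sum_nonneg)
  with insert show ?case by simp
qed simp

text \<open>The bound does not depend on the answer \<open>b\<close>: each maximal monomial
  containing \<open>i\<close> gives way to proper subsets of at most half its weight.\<close>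

lemma potential_restrict:
  assumes supp: "\<And>M. c M \<noteq> 0 \<Longrightarrow> M \<subseteq> {..<n}"
  shows "potential n (restrict_poly i b c) \<le>
    potential n c - (\<Sum>M | M \<in> maximal_monomials c \<and> i \<in> M. (3 * real n) ^ card M) / 2"
proof -
  let ?w = "\<lambda>M. (3 * real n) ^ card M"
  let ?In = "{M \<in> maximal_monomials c. i \<in> M}" and ?Out = "{M \<in> maximal_monomials c. i \<notin> M}"
  note fin = finite_maximal_monomials[OF supp] and sub = maximal_monomials_subset[OF supp]
  have fin': "finite (Pow M - {M})" if "M \<in> ?In" for M
    using that sub finite_subset[of M "{..<n}"] by auto
  have "potential n (restrict_poly i b c) \<le> sum ?w (?Out \<union> (\<Union>M\<in>?In. Pow M - {M}))"
    unfolding potential_def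
    by (rule sum_mono2[OF _ maximal_monomials_restrict[OF supp]]) (use fin fin' in auto)
  also have "\<dots> \<le> sum ?w ?Out + sum ?w (\<Union>M\<in>?In. Pow M - {M})"
    by (subst sum.union_inter[symmetric]) (use fin fin' in \<open>auto intro!: sum_nonneg\<close>)
  also have "sum ?w (\<Union>M\<in>?In. Pow M - {M}) \<le> (\<Sum>M\<in>?In. sum ?w (Pow M - {M}))"
    by (rule sum_UN_le) (use fin fin' in auto)
  also have "\<dots> \<le> (\<Sum>M\<in>?In. ?w M / 2)"
    by (rule sum_mono, rule sum_psubsets_le) (use sub in auto)
  also have "sum ?w ?Out = potential n c - sum ?w ?In"
  proof -
    have "potential n c = sum ?w (?Out \<union> ?In)"
      unfolding potential_def by (rule sum.cong) auto
    also have "\<dots> = sum ?w ?Out + sum ?w ?In"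
      by (rule sum.union_disjoint) (use fin in auto)
    finally show ?thesis by simp
  qed
  finally show ?thesis by (simp add: sum_divide_distrib[symmetric])
qed

lemma potential_nonneg: "potential n c \<ge> 0"
  unfolding potential_def by (intro sum_nonneg) auto

text \<open>Any surviving monomial costs at least 1. This lets the potential bound the cost of
  reading the whole input when the polynomial has not vanished.\<close>

lemma potential_ge_1:
  assumes "\<And>M. c M \<noteq> 0 \<Longrightarrow> M \<subseteq> {..<n}" "c N \<noteq> 0"
  shows "potential n c \<ge> 1"
proof -
  obtain M where M: "M \<in> maximal_monomials c" using ex_maximal_monomial[of c n N] assms by blast
  have "(1::real) \<le> (3 * real n) ^ card M"
  proof (cases "n = 0")
    case True
    then have "M = {}" using M assms(1) by (auto simp: maximal_monomials_def)
    then show ?thesis by simp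
  next
    case False
    then show ?thesis by (intro one_le_power) simp
  qed
  also have "\<dots> \<le> potential n c"
    unfolding potential_def
    by (rule member_le_sum[OF M]) (use finite_maximal_monomials[OF assms(1)] in auto)
  finally show ?thesis .
qed

text \<open>
  Substituting \<open>X\<close> outside \<open>M\<close> leaves a polynomial in the variables of \<open>M\<close> whose leading
  coefficient is still \<open>c M\<close>; evaluate it at the indicator of a minimal monomial \<open>B\<close>.
\<close>

lemma maximal_monomial_nonzero:
  assumes supp: "\<And>M. c M \<noteq> 0 \<Longrightarrow> M \<subseteq> {..<n}" and M: "M \<in> maximal_monomials c"
    and X: "X \<in> inputs n"
  shows "\<exists>Z\<in>inputs n. (\<forall>j<n. j \<notin> M \<longrightarrow> Z ! j = X ! j) \<and> poly_eval n c Z \<noteq> 0"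
proof -
  define g where "g N = (\<Sum>S | S \<in> Pow {..<n} \<and> S \<inter> M = N. c S * of_bool (\<forall>i\<in>S - M. X ! i))" for N
  have Mn: "M \<subseteq> {..<n}" and finM: "finite M"
    using M supp finite_subset[of M "{..<n}"] by (auto simp: maximal_monomials_def)
  \<comment> \<open>\<open>g\<close> holds the coefficients after the substitution. By maximality,
    \<open>M\<close> is the only monomial of \<open>c\<close> that contains
    \<open>M\<close>.\<close>
  have "g M = (\<Sum>S\<in>{M}. c S * of_bool (\<forall>i\<in>S - M. X ! i))"
    unfolding g_def
    by (rule sum.mono_neutral_right) (use M Mn in \<open>auto simp: maximal_monomials_def\<close>)
  then have "g M \<noteq> 0" using M by (simp add: maximal_monomials_def)
  moreover define \<G> where "\<G> = {N. N \<subseteq> M \<and> g N \<noteq> 0}"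
  ultimately have "finite \<G>" "M \<in> \<G>" using finM by simp_all
  from finite_has_minimal2[OF this] obtain B
    where "B \<in> \<G>" and min': "\<forall>N\<in>\<G>. N \<subseteq> B \<longrightarrow> B = N" by blast
  then have B: "B \<subseteq> M" "g B \<noteq> 0" by (simp_all add: \<G>_def)
  have min: "g N = 0" if "N \<subseteq> M" "N \<subseteq> B" "N \<noteq> B" for N
  proof (rule ccontr)
    assume "g N \<noteq> 0"
    then have "N \<in> \<G>" using that(1) by (simp add: \<G>_def)
    then show False using min' that(2,3) by blast
  qed
  define Z where "Z = map (\<lambda>j. if j \<in> M then j \<in> B else X ! j) [0..<n]"
  have Z: "Z ! j = (if j \<in> M then j \<in> B else X ! j)" if "j < n" for j
    using that by (simp add: Z_def)
  have "poly_eval n c Z = (\<Sum>S\<in>Pow {..<n}. c S * of_bool (\<forall>i\<in>S - M. X ! i) * of_bool (S \<inter> M \<subseteq> B))"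
    unfolding poly_eval_def
  proof (rule sum.cong)
    fix S assume "S \<in> Pow {..<n}"
    then have "(\<forall>i\<in>S. Z ! i) \<longleftrightarrow> (\<forall>i\<in>S. if i \<in> M then i \<in> B else X ! i)"
      using Z by (intro ball_cong) auto
    also have "\<dots> \<longleftrightarrow> (\<forall>i\<in>S - M. X ! i) \<and> S \<inter> M \<subseteq> B" by auto
    finally show "c S * of_bool (\<forall>i\<in>S. Z ! i) = c S * of_bool (\<forall>i\<in>S - M. X ! i) * of_bool (S \<inter> M \<subseteq> B)"
      by simp
  qed simp
  also have "\<dots> = (\<Sum>N\<in>Pow M. \<Sum>S | S \<in> Pow {..<n} \<and> S \<inter> M = N.
                    c S * of_bool (\<forall>i\<in>S - M. X ! i) * of_bool (S \<inter> M \<subseteq> B))"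
    by (rule sum.group[symmetric]) (use finM in auto)
  also have "\<dots> = (\<Sum>N\<in>Pow M. g N * of_bool (N \<subseteq> B))"
    by (rule sum.cong) (auto simp: g_def sum_distrib_right)
  \<comment> \<open>At the indicator of \<open>B\<close> only subsets of \<open>B\<close>
    contribute, and minimality leaves \<open>B\<close> alone.\<close>
  also have "\<dots> = (\<Sum>N\<in>{B}. g N * of_bool (N \<subseteq> B))"
    by (rule sum.mono_neutral_right) (use finM B min in auto)
  also have "\<dots> = g B" by simp
  finally have "poly_eval n c Z \<noteq> 0" using B by simp
  then show ?thesis using Z by (intro bexI[of _ Z]) (auto simp: Z_def inputs_def)
qed

text \<open>Exchanging the sums over positions and monomials, each maximal monomial loses half its
  weight with probability at least \<open>\<delta>\<close>. The answers \<open>b\<close> may depend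
  on the position.\<close>

lemma expected_potential_restrict:
  assumes supp: "\<And>M. c M \<noteq> 0 \<Longrightarrow> M \<subseteq> {..<n}"
    and \<mu>: "set_pmf \<mu> \<subseteq> {..<n}"
    and hit: "\<And>M. M \<in> maximal_monomials c \<Longrightarrow> \<delta> \<le> (\<Sum>i\<in>M. pmf \<mu> i)"
  shows "(\<Sum>i<n. pmf \<mu> i * potential n (restrict_poly i (b i) c)) \<le> (1 - \<delta> / 2) * potential n c"
proof -
  let ?w = "\<lambda>M. (3 * real n) ^ card M"
  let ?mm = "maximal_monomials c"
  note fin = finite_maximal_monomials[OF supp] and sub = maximal_monomials_subset[OF supp]
  have one: "(\<Sum>i<n. pmf \<mu> i) = 1" by (rule sum_pmf_eq_1) (use \<mu> in auto)
  have "(\<Sum>i<n. pmf \<mu> i * potential n (restrict_poly i (b i) c)) \<le>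
      (\<Sum>i<n. pmf \<mu> i * (potential n c - (\<Sum>M | M \<in> ?mm \<and> i \<in> M. ?w M) / 2))"
    by (intro sum_mono mult_left_mono potential_restrict supp) auto
  also have "\<dots> = potential n c - (\<Sum>i<n. \<Sum>M | M \<in> ?mm \<and> i \<in> M. pmf \<mu> i * ?w M) / 2"
    by (simp add: right_diff_distrib sum_subtractf sum_distrib_right[symmetric] one
        sum_distrib_left sum_divide_distrib)
  also have "(\<Sum>i<n. \<Sum>M | M \<in> ?mm \<and> i \<in> M. pmf \<mu> i * ?w M) = (\<Sum>M\<in>?mm. \<Sum>i | i \<in> {..<n} \<and> i \<in> M. pmf \<mu> i * ?w M)"
    by (rule sum.swap_restrict) (use fin in auto)
  also have "\<dots> = (\<Sum>M\<in>?mm. (\<Sum>i\<in>M. pmf \<mu> i) * ?w M)"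
  proof (rule sum.cong)
    fix M assume "M \<in> ?mm"
    then have "{i. i \<in> {..<n} \<and> i \<in> M} = M" using sub by auto
    then show "(\<Sum>i | i \<in> {..<n} \<and> i \<in> M. pmf \<mu> i * ?w M) = (\<Sum>i\<in>M. pmf \<mu> i) * ?w M"
      by (simp add: sum_distrib_right)
  qed simp
  finally have "(\<Sum>i<n. pmf \<mu> i * potential n (restrict_poly i (b i) c)) \<le>
     potential n c - (\<Sum>M\<in>?mm. (\<Sum>i\<in>M. pmf \<mu> i) * ?w M) / 2" .
  moreover have "(\<Sum>M\<in>?mm. (\<Sum>i\<in>M. pmf \<mu> i) * ?w M) \<ge> (\<Sum>M\<in>?mm. \<delta> * ?w M)"
    by (intro sum_mono mult_right_mono hit) auto
  moreover have "(\<Sum>M\<in>?mm. \<delta> * ?w M) = \<delta> * potential n c"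
    by (simp add: potential_def sum_distrib_left)
  ultimately show ?thesis by (simp add: algebra_simps)
qed

text \<open>Writing \<open>(3 n)^k\<close> as \<open>(3 n^2)^k / n^k\<close> bounds the first factor
  by its value at \<open>d\<close>; the sum of \<open>n^(-k)\<close> over all sets of variables is
  \<open>(1 + 1/n)^n\<close>, below 3.\<close>

lemma potential_le:
  assumes n: "n > 0" and supp: "\<And>M. c M \<noteq> 0 \<Longrightarrow> M \<subseteq> {..<n} \<and> card M \<le> d"
  shows "potential n c \<le> 3 * (3 * (real n)\<^sup>2) ^ d"
proof -
  have "potential n c \<le> (\<Sum>M\<in>maximal_monomials c. (3 * (real n)\<^sup>2) ^ d * (1 / real n) ^ card M)"
    unfolding potential_def
  proof (rule sum_mono)
    fix M assume "M \<in> maximal_monomials c"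
    then have "card M \<le> d" using supp by (simp add: maximal_monomials_def)
    have "1 * 1 \<le> 3 * (real n)\<^sup>2" using n by (intro mult_mono one_le_power) auto
    then have "(3 * (real n)\<^sup>2) ^ card M \<le> (3 * (real n)\<^sup>2) ^ d"
      using \<open>card M \<le> d\<close> by (intro power_increasing) auto
    then have "(3 * (real n)\<^sup>2) ^ card M * (1 / real n) ^ card M \<le> (3 * (real n)\<^sup>2) ^ d * (1 / real n) ^ card M"
      by (intro mult_right_mono) auto
    also have "(3 * (real n)\<^sup>2) ^ card M * (1 / real n) ^ card M = (3 * real n) ^ card M"
      unfolding power_mult_distrib[symmetric] using n by (simp add: power2_eq_square)
    finally show "(3 * real n) ^ card M \<le> (3 * (real n)\<^sup>2) ^ d * (1 / real n) ^ card M" .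
  qed
  also have "\<dots> \<le> (\<Sum>M\<in>Pow {..<n}. (3 * (real n)\<^sup>2) ^ d * (1 / real n) ^ card M)"
    by (rule sum_mono2) (use maximal_monomials_subset[of c n] supp in auto)
  also have "\<dots> = (3 * (real n)\<^sup>2) ^ d * (1 / real n + 1) ^ n"
    by (simp add: sum_distrib_left[symmetric] sum_Pow_power_card)
  also have "\<dots> \<le> (3 * (real n)\<^sup>2) ^ d * 3"
  proof (rule mult_left_mono)
    have "(1 / real n + 1) ^ n \<le> exp (1 / real n) ^ n"
      by (intro power_mono) (auto simp: add.commute intro: exp_ge_add_one_self)
    also have "\<dots> = exp 1" using n by (simp add: exp_of_nat_mult[symmetric])
    also have "\<dots> \<le> 3" by (rule exp_le)
    finally show "(1 / real n + 1) ^ n \<le> 3" .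
  qed simp
  finally show ?thesis by (simp add: mult.commute)
qed


subsection \<open>The zero-error algorithm\<close>

text \<open>The fallback that reads everything. The last bit of the prefix is queried first, so that
  the induction applies to the shorter prefix with \<open>g\<close> specialised to the
  answer.\<close>

lemma ex_full_dtree:
  "k \<le> n \<Longrightarrow> \<exists>t. dtree_valid n t \<and>
     (\<forall>Y\<in>inputs n. dtree_output t Y = g (take k Y) \<and> dtree_queries t Y = k)"
proof (induction k arbitrary: g)
  case 0
  show ?case by (rule exI[of _ "Output (g [])"]) auto
next
  case (Suc k)
  obtain t where t: "dtree_valid n (t b)"
     "\<And>Y. Y \<in> inputs n \<Longrightarrow> dtree_output (t b) Y = g (take k Y @ [b]) \<and> dtree_queries (t b) Y = k" for b
    using Suc.IH[of "\<lambda>ys. g (ys @ [b])" for b] Suc.prems by (metis Suc_leD)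
  show ?case
    by (rule exI[of _ "Query k (t False) (t True)"])
      (use t Suc.prems in \<open>auto simp: inputs_def take_Suc_conv_app_nth\<close>)
qed

text \<open>Both subtrees are drawn in advance, but on \<open>Y\<close> only the one for the answer
  \<open>Y ! i\<close> is followed, so the other integrates out.\<close>

lemma randomized_algorithm_step:
  assumes supp: "\<And>M. c M \<noteq> 0 \<Longrightarrow> M \<subseteq> {..<n}"
    and \<mu>: "set_pmf \<mu> \<subseteq> {..<n}"
    and bound: "\<And>i. i < n \<Longrightarrow>
      (\<integral>\<^sup>+ t. of_nat (dtree_queries t Y) \<partial>measure_pmf (P i (Y ! i))) \<le> ennreal (B i)"
    and B: "\<And>i. B i \<ge> 0"
  shows "(\<integral>\<^sup>+ t. of_nat (dtree_queries t Y) \<partial>measure_pmf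
      (bind_pmf \<mu> (\<lambda>i. bind_pmf (P i False) (\<lambda>t0. map_pmf (Query i t0) (P i True)))))
    \<le> ennreal (1 + (\<Sum>i<n. pmf \<mu> i * B i))"
proof -
  have "(\<integral>\<^sup>+ t. of_nat (dtree_queries t Y) \<partial>measure_pmf
      (bind_pmf \<mu> (\<lambda>i. bind_pmf (P i False) (\<lambda>t0. map_pmf (Query i t0) (P i True))))) =
    (\<integral>\<^sup>+ i. 1 + (\<integral>\<^sup>+ t. of_nat (dtree_queries t Y) \<partial>measure_pmf (P i (Y ! i))) \<partial>measure_pmf \<mu>)"
  proof -
    have "(\<integral>\<^sup>+ t0. \<integral>\<^sup>+ t1. of_nat (if Y ! i then dtree_queries t1 Y else dtree_queries t0 Y)
        \<partial>measure_pmf (P i True) \<partial>measure_pmf (P i False)) =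
      (\<integral>\<^sup>+ t. of_nat (dtree_queries t Y) \<partial>measure_pmf (P i (Y ! i)))" for i
      by (cases "Y ! i") simp_all
    then show ?thesis by (simp add: nn_integral_add)
  qed
  also have "\<dots> \<le> (\<integral>\<^sup>+ i. 1 + ennreal (B i) \<partial>measure_pmf \<mu>)"
    by (intro nn_integral_mono_AE AE_pmfI add_left_mono bound) (use \<mu> in auto)
  also have "\<dots> = 1 + (\<integral>\<^sup>+ i. ennreal (B i) \<partial>measure_pmf \<mu>)"
    by (simp add: nn_integral_add)
  also have "(\<integral>\<^sup>+ i. ennreal (B i) \<partial>measure_pmf \<mu>) = (\<Sum>i<n. ennreal (B i) * ennreal (pmf \<mu> i))"
    by (rule nn_integral_measure_pmf_support) (use \<mu> in \<open>auto simp: set_pmf_iff\<close>)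
  also have "\<dots> = ennreal (\<Sum>i<n. pmf \<mu> i * B i)"
    using B by (simp add: ennreal_mult[symmetric] sum_ennreal mult.commute)
  also have "1 + \<dots> = ennreal (1 + (\<Sum>i<n. pmf \<mu> i * B i))"
    using B by (simp add: ennreal_plus sum_nonneg)
  finally show ?thesis .
qed

text \<open>Induction on the budget \<open>K\<close> of random queries. \<open>V\<close> is the set
  of inputs consistent with the answers and \<open>c\<close> the restricted polynomial;
  \<open>closed\<close> says that variables still occurring in \<open>c\<close> may be changed
  freely within \<open>V\<close>. The second summand of the bound pays for reading all
  \<open>n\<close> bits if the polynomial is still nonzero at the end.\<close>

lemma ex_randomized_algorithm:
  assumes \<delta>: "0 \<le> \<delta>" "\<delta> \<le> 1"
    and cert: "\<And>X. X \<in> inputs n \<Longrightarrow> \<not> f X \<Longrightarrow> \<exists>\<mu>. set_pmf \<mu> \<subseteq> {..<n} \<and>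
       (\<forall>Y\<in>inputs n. f Y \<longrightarrow> \<delta> \<le> (\<Sum>i | i < n \<and> X ! i \<noteq> Y ! i. pmf \<mu> i))"
    and V: "V \<subseteq> inputs n"
    and supp: "\<And>M. c M \<noteq> 0 \<Longrightarrow> M \<subseteq> {..<n}"
    and repr: "\<And>Y. Y \<in> V \<Longrightarrow> f Y \<longleftrightarrow> poly_eval n c Y \<noteq> 0"
    and closed: "\<And>X Z. X \<in> V \<Longrightarrow> Z \<in> inputs n \<Longrightarrow>
       (\<And>j. j < n \<Longrightarrow> (\<forall>M. c M \<noteq> 0 \<longrightarrow> j \<notin> M) \<Longrightarrow> Z ! j = X ! j) \<Longrightarrow> Z \<in> V"
  shows "\<exists>p. (\<forall>t\<in>set_pmf p. dtree_valid n t \<and> (\<forall>Y\<in>V. dtree_output t Y = f Y)) \<and>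
    (\<forall>Y\<in>V. (\<integral>\<^sup>+ t. of_nat (dtree_queries t Y) \<partial>measure_pmf p) \<le>
      ennreal (real K + real n * (1 - \<delta> / 2) ^ K * potential n c))"
  using V supp repr closed
proof (induction K arbitrary: V c)
  case (0 V c)
  show ?case
  proof (cases "\<exists>N. c N \<noteq> 0")
    case False
    then have "\<And>Y. Y \<in> V \<Longrightarrow> \<not> f Y" using 0(3) by (simp add: poly_eval_def)
    then show ?thesis by (intro exI[of _ "return_pmf (Output False)"]) auto
  next
    case True
    obtain t where t: "dtree_valid n t"
      "\<And>Y. Y \<in> inputs n \<Longrightarrow> dtree_output t Y = f (take n Y) \<and> dtree_queries t Y = n"
      using ex_full_dtree[of n n f] by auto
    \<comment> \<open>Since the potential is at least 1 here, \<open>n\<close> further queries are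
      covered by \<open>n\<close> times the potential.\<close>
    have "real n \<le> real n * potential n c"
      using True potential_ge_1[of c n] 0(2) by (metis mult.right_neutral mult_left_mono of_nat_0_le_iff)
    then have "of_nat n \<le> ennreal (real n * potential n c)"
      by (simp add: ennreal_of_nat_eq_real_of_nat ennreal_leI)
    with t show ?thesis using 0(1) by (intro exI[of _ "return_pmf t"]) (auto simp: inputs_def)
  qed
next
  case (Suc K V c)
  note V = Suc.prems(1) and supp = Suc.prems(2) and repr = Suc.prems(3) and closed = Suc.prems(4)
  have d1: "0 \<le> 1 - \<delta> / 2" using \<delta> by simp
  show ?case
  \<comment> \<open>A constant value of \<open>f\<close> on \<open>V\<close> ends the computation;
    otherwise \<open>V\<close> contains a \<open>0\<close>-input \<open>X\<close> to sample
    from.\<close>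
  proof (cases "\<exists>b. \<forall>Y\<in>V. f Y = b")
    case True
    then obtain b where "\<And>Y. Y \<in> V \<Longrightarrow> f Y = b" by blast
    then show ?thesis by (intro exI[of _ "return_pmf (Output b)"]) auto
  next
    case False
    then obtain X where X: "X \<in> V" "\<not> f X" by blast
    then obtain \<mu> where \<mu>: "set_pmf \<mu> \<subseteq> {..<n}"
      "\<And>Y. Y \<in> inputs n \<Longrightarrow> f Y \<Longrightarrow> \<delta> \<le> (\<Sum>i | i < n \<and> X ! i \<noteq> Y ! i. pmf \<mu> i)"
      using cert V by blast
    \<comment> \<open>A \<open>1\<close>-input \<open>Z\<close> in \<open>V\<close> differs from
      \<open>X\<close> only inside \<open>M\<close>, so every position separating them lies in
      \<open>M\<close>.\<close>
    have hit: "\<delta> \<le> (\<Sum>i\<in>M. pmf \<mu> i)" if M: "M \<in> maximal_monomials c" for M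
    proof -
      have cM: "c M \<noteq> 0" using M by (simp add: maximal_monomials_def)
      obtain Z where Z: "Z \<in> inputs n" "\<And>j. j < n \<Longrightarrow> j \<notin> M \<Longrightarrow> Z ! j = X ! j" "poly_eval n c Z \<noteq> 0"
        using maximal_monomial_nonzero[OF supp M, of X] X V by blast
      have "Z \<in> V" by (rule closed[OF X(1) Z(1)]) (use Z(2) cM in blast)
      then have "f Z" using repr Z by simp
      then have "\<delta> \<le> (\<Sum>i | i < n \<and> X ! i \<noteq> Z ! i. pmf \<mu> i)" using \<mu> Z by blast
      also have "\<dots> \<le> (\<Sum>i\<in>M. pmf \<mu> i)"
        by (rule sum_mono2) (use Z supp[OF cM] finite_subset[of M "{..<n}"] in auto)
      finally show ?thesis .
    qed
    let ?B = "\<lambda>i b. real K + real n * (1 - \<delta> / 2) ^ K * potential n (restrict_poly i b c)"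
    have ex: "\<exists>p. (\<forall>t\<in>set_pmf p. dtree_valid n t \<and> (\<forall>Y\<in>{Y\<in>V. Y ! i = b}. dtree_output t Y = f Y)) \<and>
      (\<forall>Y\<in>{Y\<in>V. Y ! i = b}. (\<integral>\<^sup>+ t. of_nat (dtree_queries t Y) \<partial>measure_pmf p) \<le> ennreal (?B i b))"
      if i: "i < n" for i b
    proof (rule Suc.IH)
      show "{Y\<in>V. Y ! i = b} \<subseteq> inputs n" using V by auto
      show "M \<subseteq> {..<n}" if "restrict_poly i b c M \<noteq> 0" for M
        using restrict_poly_support[OF that] supp by blast
      show "f Y \<longleftrightarrow> poly_eval n (restrict_poly i b c) Y \<noteq> 0" if "Y \<in> {Y\<in>V. Y ! i = b}" for Y
        using that repr poly_eval_restrict[OF i, of Y b c] by auto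
      show "Z \<in> {Y\<in>V. Y ! i = b}" if X: "X \<in> {Y\<in>V. Y ! i = b}" and Z: "Z \<in> inputs n"
        and eq: "\<And>j. j < n \<Longrightarrow> \<forall>M. restrict_poly i b c M \<noteq> 0 \<longrightarrow> j \<notin> M \<Longrightarrow> Z ! j = X ! j" for X Z
      proof -
        have "Z ! j = X ! j" if "j < n" "\<forall>M. c M \<noteq> 0 \<longrightarrow> j \<notin> M" for j
          by (rule eq[OF that(1)]) (use that(2) restrict_poly_support[of i b c] in blast)
        then have "Z \<in> V" using X Z closed[of X Z] by blast
        moreover have "Z ! i = X ! i"
          by (rule eq[OF i]) (use restrict_poly_support(1)[of i b c] in blast)
        ultimately show ?thesis using X by auto
      qed
    qed
    obtain P where
      P: "\<And>i b t. i < n \<Longrightarrow> t \<in> set_pmf (P i b) \<Longrightarrow> dtree_valid n t"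
        "\<And>i b t Y. i < n \<Longrightarrow> t \<in> set_pmf (P i b) \<Longrightarrow> Y \<in> V \<Longrightarrow> Y ! i = b \<Longrightarrow> dtree_output t Y = f Y"
        "\<And>i b Y. i < n \<Longrightarrow> Y \<in> V \<Longrightarrow> Y ! i = b \<Longrightarrow>
          (\<integral>\<^sup>+ t. of_nat (dtree_queries t Y) \<partial>measure_pmf (P i b)) \<le> ennreal (?B i b)"
    proof -
      have "\<forall>i b. \<exists>p. i < n \<longrightarrow>
         (\<forall>t\<in>set_pmf p. dtree_valid n t \<and> (\<forall>Y\<in>{Y\<in>V. Y ! i = b}. dtree_output t Y = f Y)) \<and>
         (\<forall>Y\<in>{Y\<in>V. Y ! i = b}. (\<integral>\<^sup>+ t. of_nat (dtree_queries t Y) \<partial>measure_pmf p) \<le> ennreal (?B i b))"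
        using ex by blast
      then show ?thesis
        unfolding choice_iff using that by blast
    qed
    define p where
      "p = bind_pmf \<mu> (\<lambda>i. bind_pmf (P i False) (\<lambda>t0. map_pmf (Query i t0) (P i True)))"
    show ?thesis
    proof (intro exI[of _ p] conjI ballI)
      fix t assume "t \<in> set_pmf p"
      then obtain i t0 t1 where t: "i < n" "t0 \<in> set_pmf (P i False)" "t1 \<in> set_pmf (P i True)"
        "t = Query i t0 t1"
        using \<mu>(1) by (auto simp: p_def)
      show "dtree_valid n t" using t P(1) by auto
      show "dtree_output t Y = f Y" if "Y \<in> V" for Y using t P(2) that by auto
    next
      fix Y assume Y: "Y \<in> V"
      let ?r = "real n * (1 - \<delta> / 2) ^ K"
      have r: "?r \<ge> 0" using d1 by simp
      have K: "(\<Sum>i<n. real K * pmf \<mu> i) = real K"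
        using sum_pmf_eq_1[of "{..<n}" \<mu>] \<mu>(1) by (simp add: sum_distrib_left[symmetric])
      have "(\<integral>\<^sup>+ t. of_nat (dtree_queries t Y) \<partial>measure_pmf p) \<le>
          ennreal (1 + (\<Sum>i<n. pmf \<mu> i * ?B i (Y ! i)))"
        unfolding p_def
        by (rule randomized_algorithm_step[OF supp \<mu>(1)])
          (use P(3) Y r potential_nonneg in auto)
      also have "1 + (\<Sum>i<n. pmf \<mu> i * ?B i (Y ! i)) =
          1 + real K + ?r * (\<Sum>i<n. pmf \<mu> i * potential n (restrict_poly i (Y ! i) c))"
        by (simp add: distrib_left sum.distrib K sum_distrib_left mult_ac)
      also have "\<dots> \<le> 1 + real K + ?r * ((1 - \<delta> / 2) * potential n c)"
        by (intro add_left_mono mult_left_mono[OF _ r] expected_potential_restrict supp \<mu>(1) hit)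
      also have "\<dots> = real (Suc K) + real n * (1 - \<delta> / 2) ^ Suc K * potential n c"
        by (simp add: mult_ac)
      finally show "(\<integral>\<^sup>+ t. of_nat (dtree_queries t Y) \<partial>measure_pmf p) \<le>
          ennreal (real (Suc K) + real n * (1 - \<delta> / 2) ^ Suc K * potential n c)"
        by (simp add: ennreal_leI)
    qed
  qed
qed

section \<open>From the algorithm to the bound on \<open>R0\<close>\<close>

lemma R0_leI:
  assumes "\<forall>t\<in>set_pmf p. dtree_valid n t \<and> (\<forall>Y\<in>inputs n. dtree_output t Y = f Y)"
    and "\<And>Y. Y \<in> inputs n \<Longrightarrow> (\<integral>\<^sup>+ t. of_nat (dtree_queries t Y) \<partial>measure_pmf p) \<le> B"
  shows "R0 n f \<le> B"
proof -
  have "zero_error_randomized n f p"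
    unfolding zero_error_randomized_def
    using assms(1) by (auto simp: measure_pmf.prob_eq_1 AE_measure_pmf_iff)
  then show ?thesis
    unfolding R0_def by (intro INF_lower2[of p] SUP_least assms(2)) auto
qed

lemma R0_const:
  assumes "\<And>Y. Y \<in> inputs n \<Longrightarrow> f Y = b"
  shows "R0 n f \<le> 0"
  by (rule R0_leI[of "return_pmf (Output b)"]) (use assms in auto)

lemma R0_le_steps:
  assumes n: "n > 0" and T: "Q2 n f > 0"
  shows "R0 n f \<le> ennreal (real K + real n * (1 - 1 / (200 * (real (Q2 n f))\<^sup>2)) ^ K *
    (3 * (3 * (real n)\<^sup>2) ^ (2 * Q0 n f)))"
proof -
  let ?\<delta> = "1 / (100 * (real (Q2 n f))\<^sup>2)"
  obtain A where A: "qalgorithm_valid n (Q2 n f) A"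
    "\<And>Y. Y \<in> inputs n \<Longrightarrow> output_prob n (Q2 n f) A Y (f Y) \<ge> 2 / 3"
    by (rule Q2_algorithm[OF n, of f]) blast
  obtain c where c: "\<And>M. c M \<noteq> 0 \<Longrightarrow> M \<subseteq> {..<n} \<and> card M \<le> 2 * Q0 n f"
    "\<And>Y. Y \<in> inputs n \<Longrightarrow> f Y \<longleftrightarrow> poly_eval n c Y \<noteq> 0"
    using ex_nondeterministic_polynomial[OF n, of f] by auto
  have "1 \<le> (real (Q2 n f))\<^sup>2" using T by (intro one_le_power) simp
  then have "?\<delta> \<le> 1 / 1" by (intro frac_le) auto
  then have \<delta>: "0 \<le> ?\<delta>" "?\<delta> \<le> 1" by auto
  have "\<exists>p. (\<forall>t\<in>set_pmf p. dtree_valid n t \<and> (\<forall>Y\<in>inputs n. dtree_output t Y = f Y)) \<and>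
    (\<forall>Y\<in>inputs n. (\<integral>\<^sup>+ t. of_nat (dtree_queries t Y) \<partial>measure_pmf p) \<le>
      ennreal (real K + real n * (1 - ?\<delta> / 2) ^ K * potential n c))"
  proof (rule ex_randomized_algorithm[OF \<delta>])
    fix X assume X: "X \<in> inputs n" "\<not> f X"
    obtain \<mu> where "set_pmf \<mu> \<subseteq> {..<n}" "\<forall>Y\<in>inputs n. f Y \<noteq> f X \<longrightarrow>
        ?\<delta> \<le> (\<Sum>i | i < n \<and> X ! i \<noteq> Y ! i. pmf \<mu> i)"
      using ex_query_distribution[of n "Q2 n f" A f, OF A(1) n T A(2) X(1)] by blast
    then show "\<exists>\<mu>. set_pmf \<mu> \<subseteq> {..<n} \<and>
       (\<forall>Y\<in>inputs n. f Y \<longrightarrow> ?\<delta> \<le> (\<Sum>i | i < n \<and> X ! i \<noteq> Y ! i. pmf \<mu> i))"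
      using X(2) by blast
  qed (use c in auto)
  then obtain p where p: "\<forall>t\<in>set_pmf p. dtree_valid n t \<and> (\<forall>Y\<in>inputs n. dtree_output t Y = f Y)"
    "\<And>Y. Y \<in> inputs n \<Longrightarrow> (\<integral>\<^sup>+ t. of_nat (dtree_queries t Y) \<partial>measure_pmf p) \<le>
      ennreal (real K + real n * (1 - ?\<delta> / 2) ^ K * potential n c)" by blast
  have "R0 n f \<le> ennreal (real K + real n * (1 - ?\<delta> / 2) ^ K * potential n c)"
    by (rule R0_leI[OF p])
  also have "\<dots> \<le> ennreal (real K + real n * (1 - ?\<delta> / 2) ^ K * (3 * (3 * (real n)\<^sup>2) ^ (2 * Q0 n f)))"
    using \<delta> by (intro ennreal_leI add_left_mono mult_left_mono potential_le n c(1)) auto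
  finally show ?thesis by simp
qed

text \<open>Constant functions cost nothing and are treated apart. For the others all three factors
  of the bound are at least 1, so additive constants can be absorbed.\<close>

lemma R0_bound:
  assumes n: "n \<ge> 2"
  shows "R0 n f \<le> ennreal (3000 * (real (Q2 n f))\<^sup>2 * real (Q0 n f) * log 2 (real n))"
proof (cases "\<exists>b. \<forall>Y\<in>inputs n. f Y = b")
  case True
  then have "R0 n f \<le> 0" using R0_const by blast
  then show ?thesis by simp
next
  case False
  then obtain X Y where XY: "X \<in> inputs n" "Y \<in> inputs n" "f X \<noteq> f Y" by (metis (full_types))
  have n0: "n > 0" using n by simp
  let ?T = "real (Q2 n f)" and ?d = "real (Q0 n f)" and ?l = "log 2 (real n)"
  obtain A where "qalgorithm_valid n (Q2 n f) A"
    "\<And>Y. Y \<in> inputs n \<Longrightarrow> output_prob n (Q2 n f) A Y (f Y) \<ge> 2 / 3"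
    by (rule Q2_algorithm[OF n0, of f]) blast
  from queries_pos[of n "Q2 n f" A f, OF this(1) n0 this(2) XY] have T: "Q2 n f > 0" .
  \<comment> \<open>A polynomial of degree 0 is constant and would make \<open>f\<close>
    constant.\<close>
  have d: "Q0 n f > 0"
  proof (rule ccontr)
    assume "\<not> Q0 n f > 0"
    then obtain c where c: "\<And>M. c M \<noteq> 0 \<Longrightarrow> M \<subseteq> {..<n} \<and> card M \<le> 0"
      "\<And>Y. Y \<in> inputs n \<Longrightarrow> f Y \<longleftrightarrow> poly_eval n c Y \<noteq> 0"
      using ex_nondeterministic_polynomial[OF n0, of f] by auto
    have "poly_eval n c Y = c {}" for Y
    proof -
      have "poly_eval n c Y = (\<Sum>M\<in>{{}}. c M * of_bool (\<forall>i\<in>M. Y ! i))"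
        unfolding poly_eval_def
        by (rule sum.mono_neutral_right) (use c(1) finite_subset in fastforce)+
      then show ?thesis by simp
    qed
    then show False using c(2) XY by simp
  qed
  have T1: "?T\<^sup>2 \<ge> 1" using T by (intro one_le_power) simp
  have d1: "?d \<ge> 1" using d by simp
  have l1: "?l \<ge> 1" using n by simp
  define B where "B = real n * (3 * (3 * (real n)\<^sup>2) ^ (2 * Q0 n f))"
  have B0: "B > 0" using n by (simp add: B_def)
  \<comment> \<open>Bounding \<open>log 2 3\<close> by 2 gives
    \<open>log 2 B \<le> l + 2 + 4 d + 4 d l\<close>, at most \<open>11 d l\<close> as
    \<open>d\<close> and \<open>l\<close> are at least 1; 14 leaves slack.\<close>
  have lnB: "ln B \<le> 14 * ?d * ?l"
  proof -
    have "log 2 B = ?l + (log 2 3 + 2 * ?d * (log 2 3 + 2 * ?l))"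
      using n by (simp add: B_def log_mult log_nat_power algebra_simps)
    moreover have "log 2 (3::real) \<le> 2"
      by (simp add: log_le_iff)
    moreover from this have "2 * ?d * (log 2 3 + 2 * ?l) \<le> 2 * ?d * (2 + 2 * ?l)"
      by (intro mult_left_mono) auto
    ultimately have "log 2 B \<le> ?l + 2 + 2 * ?d * (2 + 2 * ?l)" by linarith
    also have "\<dots> = ?l + 2 + 4 * ?d + 4 * (?d * ?l)" by (simp add: algebra_simps)
    also have "\<dots> \<le> 14 * (?d * ?l)"
    proof -
      have "?d * 1 \<le> ?d * ?l" "1 * ?l \<le> ?d * ?l"
        using d1 l1 by (intro mult_left_mono mult_right_mono; simp)+
      then show ?thesis using d1 unfolding mult_1_left mult_1_right by linarith
    qed
    also have "\<dots> = 14 * ?d * ?l" by simp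
    finally have "log 2 B \<le> 14 * ?d * ?l" .
    then have "log 2 B * ln 2 \<le> 14 * ?d * ?l * ln 2" by (intro mult_right_mono) auto
    also have "\<dots> \<le> 14 * ?d * ?l * 1"
      using ln_2_less_1 d1 l1 by (intro mult_left_mono) auto
    also have "log 2 B * ln 2 = ln B" by (simp add: log_def)
    finally show ?thesis by simp
  qed
  \<comment> \<open>Chosen so that \<open>(1 - 1 / (200 T^2))^K\<close> is at most
    \<open>1 / B\<close>, which makes the expected cost of the fallback at most 1.\<close>
  define K where "K = nat \<lceil>200 * ?T\<^sup>2 * ln B\<rceil>"
  have "B * (1 - 1 / (200 * ?T\<^sup>2)) ^ K \<le> 1"
  proof -
    have "(1 - 1 / (200 * ?T\<^sup>2)) ^ K \<le> exp (- (1 / (200 * ?T\<^sup>2))) ^ K"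
    proof (rule power_mono)
      show "1 - 1 / (200 * ?T\<^sup>2) \<le> exp (- (1 / (200 * ?T\<^sup>2)))"
        using exp_ge_add_one_self[of "- (1 / (200 * ?T\<^sup>2))"] by simp
      have "1 / (200 * ?T\<^sup>2) \<le> 1 / 1" using T1 by (intro frac_le) auto
      then show "0 \<le> 1 - 1 / (200 * ?T\<^sup>2)" by simp
    qed
    also have "\<dots> = exp (- (real K / (200 * ?T\<^sup>2)))" by (simp add: exp_of_nat_mult[symmetric])
    also have "\<dots> \<le> exp (- ln B)"
    proof -
      have "200 * ?T\<^sup>2 * ln B \<le> real K" by (simp add: K_def real_nat_ceiling_ge)
      moreover have "0 < 200 * ?T\<^sup>2" using T1 by linarith
      ultimately have "ln B \<le> real K / (200 * ?T\<^sup>2)"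
        by (subst pos_le_divide_eq) (simp_all add: mult.commute)
      then show ?thesis by simp
    qed
    also have "\<dots> = 1 / B" using B0 by (simp add: exp_minus inverse_eq_divide)
    finally show ?thesis using B0 by (simp add: pos_le_divide_eq mult.commute)
  qed
  moreover have "real K \<le> 2800 * ?T\<^sup>2 * ?d * ?l + 1"
  proof -
    have "200 * ?T\<^sup>2 * ln B \<le> 200 * ?T\<^sup>2 * (14 * ?d * ?l)" using lnB by (intro mult_left_mono) auto
    moreover have "0 \<le> 200 * ?T\<^sup>2 * (14 * ?d * ?l)" using d1 l1 by simp
    moreover have "real K \<le> max 0 (200 * ?T\<^sup>2 * ln B + 1)" unfolding K_def by linarith
    ultimately show ?thesis by (simp add: mult_ac)
  qed
  moreover have "1 \<le> ?T\<^sup>2 * ?d * ?l"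
    using T1 d1 l1 by (intro mult_ge1_I) auto
  \<comment> \<open>Here \<open>2800 = 200 * 14\<close>; the ceiling and the fallback add 1 each,
    and \<open>2802\<close> is below \<open>3000\<close>.\<close>
  ultimately have "real K + B * (1 - 1 / (200 * ?T\<^sup>2)) ^ K \<le> 3000 * ?T\<^sup>2 * ?d * ?l"
    by linarith
  then have "ennreal (real K + B * (1 - 1 / (200 * ?T\<^sup>2)) ^ K) \<le> ennreal (3000 * ?T\<^sup>2 * ?d * ?l)"
    by (rule ennreal_leI)
  moreover have "R0 n f \<le> ennreal (real K + B * (1 - 1 / (200 * ?T\<^sup>2)) ^ K)"
    using R0_le_steps[OF n0 T, of K] by (simp add: B_def mult_ac)
  ultimately show ?thesis by (rule order_trans[rotated])
qed

theorem theorem11: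
  shows "\<exists>c::real. c > 0 \<and>
    (\<forall>n\<ge>2. \<forall>f :: bool list \<Rightarrow> bool.
       R0 n f \<le> ennreal (c * (real (Q2 n f))\<^sup>2 * real (Q0 n f) * log 2 (real n)))"
  using R0_bound by (intro exI[of _ 3000]) auto

end
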